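(* There exists an inductive sequence $(A_i,\varphi_i)_{i\ge 1}$ of building blocks $A_i=A(n_i,(a_i+1)n_i)$, with connecting maps $\varphi_{ij}:A_i\to A_j$, such that each connecting map $\varphi_{ij}$ is a $*$-homomorphism of the form $$\varphi_{ij}(f)=u\,\mathrm{diag}(f\circ\xi_1,\,f\circ\xi_2,\,\ldots,\,f\circ\xi_m)\,u^*\qquad (f\in A_i)$$ for some unitary $u\in C([0,1],M_{n_j'})$, where $n_j'=(a_j+1)n_j$, and some continuous maps $\xi_1,\dots,\xi_m:[0,1]\to[0,1]$ (with $m$, $u$ and the $\xi_k$ depending on $i$ and $j$) that satisfy (1) $|\xi_k(x)-\xi_k(y)|\le (1/2)^{j-i}$ for every $x,y\in[0,1]$ and $1\le k\le m$; and (2) $\bigcup_{k=1}^m \xi_k([0,1])=[0,1]$.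
   Context: For natural numbers $n,n'$ with $n\mid n'$ and $a:=\frac{n'}{n}-1>0$, the building block $A(n,n')$ is the $C^*$-algebra of all $f\in C([0,1],M_{n'})$ for which there is $c\in M_n$ with $f(0)=\mathrm{diag}(c,\ldots,c,0_n)$ ($a$ copies of $c$, followed by the zero $n\times n$ matrix) and $f(1)=\mathrm{diag}(c,\ldots,c)$ ($a+1$ copies of $c$). Here $M_k$ denotes the complex $k\times k$ matrices. In an inductive sequence $(A_i,\varphi_i)$ with $\varphi_i:A_i\to A_{i+1}$, one writes $\varphi_{ij}=\varphi_{j-1}\circ\cdots\circ\varphi_i:A_i\to A_j$ for $j\ge i$. *)

theory Defs
  imports Complex_Main "HOL-Library.FuncSet" "Jordan_Normal_Form.Schur_Decomposition"
begin

text \<open>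
  \<open>C([0,1], M\<^sub>k)\<close>. Elements are extensional functions, so that equality of functions is
  equality on \<open>[0,1]\<close>. The type of matrices carries no topology; since \<open>M\<^sub>k\<close> is finite-dimensional,
  norm continuity is continuity of all entries.
\<close>

definition cont_mat :: "nat \<Rightarrow> (real \<Rightarrow> complex mat) set" where
  "cont_mat k = {f \<in> {0..1} \<rightarrow>\<^sub>E carrier_mat k k.
     \<forall>r<k. \<forall>s<k. continuous_on {0..1} (\<lambda>t. f t $$ (r, s))}"

definition cm_add ::
  "(real \<Rightarrow> complex mat) \<Rightarrow> (real \<Rightarrow> complex mat) \<Rightarrow> real \<Rightarrow> complex mat" where
  "cm_add f g = (\<lambda>t\<in>{0..1}. f t + g t)"

definition cm_smult :: "complex \<Rightarrow> (real \<Rightarrow> complex mat) \<Rightarrow> real \<Rightarrow> complex mat" where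
  "cm_smult z f = (\<lambda>t\<in>{0..1}. z \<cdot>\<^sub>m f t)"

definition cm_mult ::
  "(real \<Rightarrow> complex mat) \<Rightarrow> (real \<Rightarrow> complex mat) \<Rightarrow> real \<Rightarrow> complex mat" where
  "cm_mult f g = (\<lambda>t\<in>{0..1}. f t * g t)"

definition cm_star :: "(real \<Rightarrow> complex mat) \<Rightarrow> real \<Rightarrow> complex mat" where
  "cm_star f = (\<lambda>t\<in>{0..1}. mat_adjoint (f t))"

definition cm_one :: "nat \<Rightarrow> real \<Rightarrow> complex mat" where
  "cm_one k = (\<lambda>t\<in>{0..1}. 1\<^sub>m k)"

definition cm_unitary :: "nat \<Rightarrow> (real \<Rightarrow> complex mat) \<Rightarrow> bool" where
  "cm_unitary k u \<longleftrightarrow> u \<in> cont_mat k \<and>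
     cm_mult (cm_star u) u = cm_one k \<and> cm_mult u (cm_star u) = cm_one k"

text \<open>
  The building block \<open>A(n,n')\<close>, to be used only for \<open>0 < n\<close>, \<open>n dvd n'\<close> and \<open>a = n'/n - 1 > 0\<close>,
  so that the natural number operations below are exact.
\<close>

definition building_block :: "nat \<Rightarrow> nat \<Rightarrow> (real \<Rightarrow> complex mat) set" where
  "building_block n n' = (let a = n' div n - 1 in
     {f \<in> cont_mat n'. \<exists>c \<in> carrier_mat n n.
        f 0 = diag_block_mat (replicate a c @ [0\<^sub>m n n]) \<and>
        f 1 = diag_block_mat (replicate (a + 1) c)})"

text \<open>
  *-homomorphisms between *-subalgebras of algebras \<open>C([0,1], M\<^sub>k)\<close> (not required to be unital).
\<close>

definition star_hom ::
  "(real \<Rightarrow> complex mat) set \<Rightarrow> (real \<Rightarrow> complex mat) set \<Rightarrow>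
   ((real \<Rightarrow> complex mat) \<Rightarrow> real \<Rightarrow> complex mat) \<Rightarrow> bool" where
  "star_hom A B \<phi> \<longleftrightarrow> \<phi> \<in> A \<rightarrow> B \<and>
     (\<forall>f\<in>A. \<forall>g\<in>A. \<phi> (cm_add f g) = cm_add (\<phi> f) (\<phi> g)) \<and>
     (\<forall>z. \<forall>f\<in>A. \<phi> (cm_smult z f) = cm_smult z (\<phi> f)) \<and>
     (\<forall>f\<in>A. \<forall>g\<in>A. \<phi> (cm_mult f g) = cm_mult (\<phi> f) (\<phi> g)) \<and>
     (\<forall>f\<in>A. \<phi> (cm_star f) = cm_star (\<phi> f))"

text \<open>Sequences are indexed by \<open>i \<ge> 1\<close>; values at index \<open>0\<close> are irrelevant.\<close>

definition inductive_sequence ::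
  "(nat \<Rightarrow> (real \<Rightarrow> complex mat) set) \<Rightarrow>
   (nat \<Rightarrow> (real \<Rightarrow> complex mat) \<Rightarrow> real \<Rightarrow> complex mat) \<Rightarrow> bool" where
  "inductive_sequence A \<phi> \<longleftrightarrow> (\<forall>i\<ge>1. star_hom (A i) (A (Suc i)) (\<phi> i))"

text \<open>\<open>\<phi>\<^sub>i\<^sub>j = \<phi>\<^sub>j\<^sub>-\<^sub>1 \<circ> \<dots> \<circ> \<phi>\<^sub>i\<close>, the identity for \<open>j = i\<close>.\<close>

definition connecting_map ::
  "(nat \<Rightarrow> (real \<Rightarrow> complex mat) \<Rightarrow> real \<Rightarrow> complex mat) \<Rightarrow>
   nat \<Rightarrow> nat \<Rightarrow> (real \<Rightarrow> complex mat) \<Rightarrow> real \<Rightarrow> complex mat" where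
  "connecting_map \<phi> i j = fold \<phi> [i..<j]"

text \<open>\<open>diag(f \<circ> \<xi>\<^sub>1, \<dots>, f \<circ> \<xi>\<^sub>m)\<close>; the maps are numbered from \<open>1\<close>.\<close>

definition diag_comp ::
  "(real \<Rightarrow> complex mat) \<Rightarrow> nat \<Rightarrow> (nat \<Rightarrow> real \<Rightarrow> real) \<Rightarrow> real \<Rightarrow> complex mat" where
  "diag_comp f m \<xi> = (\<lambda>t\<in>{0..1}. diag_block_mat (map (\<lambda>k. f (\<xi> k t)) [1..<Suc m]))"

end

theory Submission
  imports Defs "HOL-Combinatorics.Permutations"
begin

text \<open>
  Starting from \<open>A(n, (a+1)n)\<close>, put \<open>b = 2a+1\<close> and map to \<open>A(bn, (b+1)bn)\<close> by \<open>2b\<close> maps \<open>\<xi>\<^sub>k\<close>: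
  \<open>b\<close> times \<open>t/2\<close>, once the constant \<open>1/2\<close>, and \<open>b-1\<close> times \<open>(t+1)/2\<close>. At \<open>t = 0\<close> the
  diagonal consists of \<open>b\<close> copies of \<open>f(0)\<close> and \<open>b\<close> copies of \<open>f(1/2)\<close>, that is, up to a permutation,
  of \<open>b\<close> copies of \<open>d = diag(c, \<dots>, c, f(1/2))\<close> and a zero block of size \<open>bn\<close>; at \<open>t = 1\<close>
  it consists of \<open>b+1\<close> copies of \<open>d\<close>, again up to a permutation. A permutation matrix is
  connected to the identity by a path of unitaries, so a single \<open>u\<close> realises both
  permutations at the two ends. Diagonal forms compose, and each step halves the Lipschitz constant
  of the maps \<open>\<xi>\<^sub>k\<close>.
\<close>

text \<open>The constants are forced by the demand that the same \<open>d\<close> appear at both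
  ends. The \<open>b\<close> zero blocks of size \<open>n\<close> that come with \<open>b\<close>
  copies of \<open>f 0\<close> must fill one zero block of the target, so its size is
  \<open>b * n\<close>; it must also be the size \<open>a * n + (a + 1) * n\<close> of
  \<open>d\<close>, hence \<open>b = 2 * a + 1\<close>. The target has \<open>b\<close> copies of
  \<open>d\<close> at 0 but \<open>b + 1\<close> at 1, so one more \<open>f (1/2)\<close> is
  required at 1 than at 0: the constant map supplies \<open>f (1/2)\<close> at both ends and makes
  up this difference. The other \<open>b - 1\<close> blocks at 1 are copies of \<open>f 1\<close>;
  they contain \<open>(b - 1) * (a + 1) = 2 * a * (a + 1) = (b + 1) * a\<close> copies of
  \<open>c\<close>, just as many as \<open>b + 1\<close> copies of \<open>d\<close> take. The
  rearrangements concern positions only, so \<open>u\<close> does not depend on \<open>f\<close>;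
  and since a building block restricts its elements only at the ends, any continuous path of
  unitaries between the two permutation matrices will do.\<close>

subsection \<open>Block diagonal matrices\<close>

lemma div_less_mult: "r < m * N \<Longrightarrow> r div N < m" for r m N :: nat
  by (simp add: less_mult_imp_div_less)

lemma mod_less_mult: "r < m * N \<Longrightarrow> r mod N < N" for r m N :: nat
  by (cases N) auto

lemma block_index_less: "q < m \<Longrightarrow> y < N \<Longrightarrow> q * N + y < m * N" for q m y N :: nat
proof -
  assume "q < m" "y < N"
  then have "q * N + y < Suc q * N" by simp
  also have "\<dots> \<le> m * N" using \<open>q < m\<close> by (intro mult_le_mono1) simp
  finally show ?thesis .
qed

lemma block_index_div_mod:
  "y < N \<Longrightarrow> (q * N + y) div N = q" "y < N \<Longrightarrow> (q * N + y) mod N = y" for q y N :: nat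
  by auto

lemma eq_if_div_mod_eq: "r div N = s div N \<Longrightarrow> r mod N = s mod N \<Longrightarrow> r = s" for r s N :: nat
  by (metis div_mult_mod_eq)

text \<open>All blocks have one size \<open>N\<close>, so an index is a pair of block number
  (\<open>div\<close>) and offset (\<open>mod\<close>). This entrywise form replaces the recursive
  \<open>diag_block_mat\<close> in every computation below. Blocks are numbered from 0, the maps
  \<open>\<xi> k\<close> from 1.\<close>

definition bdiag :: "nat \<Rightarrow> nat \<Rightarrow> (nat \<Rightarrow> complex mat) \<Rightarrow> complex mat" where
  "bdiag m N F = mat (m * N) (m * N)
     (\<lambda>(r, s). if r div N = s div N then F (r div N) $$ (r mod N, s mod N) else 0)"

lemma bdiag_carrier [simp]: "bdiag m N F \<in> carrier_mat (m * N) (m * N)"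
  by (simp add: bdiag_def)

lemma index_bdiag:
  "r < m * N \<Longrightarrow> s < m * N \<Longrightarrow> bdiag m N F $$ (r, s) =
     (if r div N = s div N then F (r div N) $$ (r mod N, s mod N) else 0)"
  by (simp add: bdiag_def)

lemma diag_block_mat_map_eq_bdiag:
  assumes "\<And>k. k < m \<Longrightarrow> F k \<in> carrier_mat N N"
  shows "diag_block_mat (map F [0..<m]) = bdiag m N F"
  using assms
proof (induction m)
  case 0
  then show ?case by (auto simp: bdiag_def)
next
  case (Suc m)
  have IH: "diag_block_mat (map F [0..<m]) = bdiag m N F"
    using Suc by simp
  have F: "F m \<in> carrier_mat N N" using Suc by simp
  have "diag_block_mat (map F [0..<Suc m]) =
      four_block_mat (bdiag m N F) (0\<^sub>m (m * N) N) (0\<^sub>m N (m * N)) (F m)"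
    using F by (simp add: diag_block_mat_last IH Let_def bdiag_def del: diag_block_mat.simps)
  also have "\<dots> = bdiag (Suc m) N F"
  proof (rule eq_matI)
    fix r s
    assume "r < dim_row (bdiag (Suc m) N F)" "s < dim_col (bdiag (Suc m) N F)"
    then have rs: "r < m * N + N" "s < m * N + N" by (simp_all add: bdiag_def)
    have *: "x div N = m \<and> x mod N = x - m * N" if "x < m * N + N" "\<not> x < m * N" for x
      using that div_less_mult[of "x - m * N" 1 N]
      by (metis add.commute add_diff_cancel_right' div_nat_eqI mod_div_decomp
          mult.commute mult_Suc_right not_le_imp_less leI)
    have **: "x div N < m" if "x < m * N" for x using that by (rule div_less_mult)
    show "four_block_mat (bdiag m N F) (0\<^sub>m (m * N) N) (0\<^sub>m N (m * N)) (F m) $$ (r, s) =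
        bdiag (Suc m) N F $$ (r, s)"
      using rs F *[of r] *[of s] **[of r] **[of s]
      by (cases "r < m * N"; cases "s < m * N") (auto simp: bdiag_def)
  qed (use F in \<open>auto simp: bdiag_def\<close>)
  finally show ?case .
qed

lemma bdiag_cong:
  "(\<And>k. k < m \<Longrightarrow> F k = G k) \<Longrightarrow> bdiag m N F = bdiag m N G"
  unfolding bdiag_def by (intro cong_mat) (auto dest: div_less_mult)

text \<open>In a product of block diagonal matrices only one block contributes to the sum over the
  inner index.\<close>

lemma sum_block:
  fixes h :: "nat \<Rightarrow> complex"
  assumes "q < m"
  shows "(\<Sum>x\<in>{0..<m * N}. if x div N = q then h (x mod N) else 0) = (\<Sum>y\<in>{0..<N}. h y)"
proof -
  have "(\<Sum>x\<in>{0..<m * N}. if x div N = q then h (x mod N) else 0) =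
      (\<Sum>x\<in>{x\<in>{0..<m * N}. x div N = q}. h (x mod N))"
    by (intro sum.inter_filter [symmetric]) simp
  also have "\<dots> = (\<Sum>y\<in>{0..<N}. h y)"
    by (intro sum.reindex_bij_witness[of _ "\<lambda>y. q * N + y" "\<lambda>x. x mod N"])
       (auto simp: block_index_less[OF assms] mod_less_mult)
  finally show ?thesis .
qed

lemma bdiag_mult:
  assumes "\<And>k. k < m \<Longrightarrow> F k \<in> carrier_mat N N" "\<And>k. k < m \<Longrightarrow> G k \<in> carrier_mat N N"
  shows "bdiag m N F * bdiag m N G = bdiag m N (\<lambda>k. F k * G k)"
proof (rule eq_matI)
  fix r s
  assume "r < dim_row (bdiag m N (\<lambda>k. F k * G k))" "s < dim_col (bdiag m N (\<lambda>k. F k * G k))"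
  then have rs: "r < m * N" "s < m * N" by (simp_all add: bdiag_def)
  have q: "r div N < m" "s div N < m" and rN: "r mod N < N" "s mod N < N"
    using rs by (auto simp: div_less_mult mod_less_mult)
  have F: "F (r div N) \<in> carrier_mat N N" "G (r div N) \<in> carrier_mat N N"
    using assms q by auto
  have "(bdiag m N F * bdiag m N G) $$ (r, s) =
     (\<Sum>x\<in>{0..<m * N}. (if r div N = x div N then F (r div N) $$ (r mod N, x mod N) else 0) *
        (if x div N = s div N then G (x div N) $$ (x mod N, s mod N) else 0))"
    using rs by (simp add: bdiag_def scalar_prod_def)
  also have "\<dots> = (\<Sum>x\<in>{0..<m * N}. if x div N = r div N then
      (if r div N = s div N then F (r div N) $$ (r mod N, x mod N) *
        G (r div N) $$ (x mod N, s mod N) else 0) else 0)"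
    by (intro sum.cong) auto
  also have "\<dots> = (\<Sum>y\<in>{0..<N}. (if r div N = s div N then F (r div N) $$ (r mod N, y) *
        G (r div N) $$ (y, s mod N) else 0))"
    using q by (subst sum_block[symmetric, OF q(1)]) (auto intro!: sum.cong)
  also have "\<dots> = bdiag m N (\<lambda>k. F k * G k) $$ (r, s)"
    using rs F rN by (auto simp: bdiag_def scalar_prod_def)
  finally show "(bdiag m N F * bdiag m N G) $$ (r, s) = bdiag m N (\<lambda>k. F k * G k) $$ (r, s)" .
qed (auto simp: bdiag_def)

lemma bdiag_add:
  assumes "\<And>k. k < m \<Longrightarrow> F k \<in> carrier_mat N N" "\<And>k. k < m \<Longrightarrow> G k \<in> carrier_mat N N"
  shows "bdiag m N (\<lambda>k. F k + G k) = bdiag m N F + bdiag m N G"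
proof (rule eq_matI)
  fix r s
  assume "r < dim_row (bdiag m N F + bdiag m N G)" "s < dim_col (bdiag m N F + bdiag m N G)"
  then have rs: "r < m * N" "s < m * N" by (simp_all add: bdiag_def)
  then have "G (r div N) \<in> carrier_mat N N" by (auto intro!: assms div_less_mult)
  with rs show "bdiag m N (\<lambda>k. F k + G k) $$ (r, s) = (bdiag m N F + bdiag m N G) $$ (r, s)"
    by (auto simp: bdiag_def mod_less_mult)
qed (auto simp: bdiag_def)

lemma bdiag_smult:
  assumes "\<And>k. k < m \<Longrightarrow> F k \<in> carrier_mat N N"
  shows "bdiag m N (\<lambda>k. z \<cdot>\<^sub>m F k) = z \<cdot>\<^sub>m bdiag m N F"
proof (rule eq_matI)
  fix r s
  assume "r < dim_row (z \<cdot>\<^sub>m bdiag m N F)" "s < dim_col (z \<cdot>\<^sub>m bdiag m N F)"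
  then have rs: "r < m * N" "s < m * N" by (simp_all add: bdiag_def)
  then have "F (r div N) \<in> carrier_mat N N" by (auto intro!: assms div_less_mult)
  with rs show "bdiag m N (\<lambda>k. z \<cdot>\<^sub>m F k) $$ (r, s) = (z \<cdot>\<^sub>m bdiag m N F) $$ (r, s)"
    by (auto simp: bdiag_def mod_less_mult)
qed (auto simp: bdiag_def)

section \<open>Adjoints of complex matrices\<close>

lemma dim_mat_adjoint [simp]:
  "dim_row (mat_adjoint A) = dim_col A" "dim_col (mat_adjoint A) = dim_row A"
  by (simp_all add: mat_adjoint_def)

lemma mat_adjoint_carrier [simp]:
  "A \<in> carrier_mat n m \<Longrightarrow> mat_adjoint A \<in> carrier_mat m n"
  by (intro carrier_matI) auto

lemma index_mat_adjoint [simp]: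
  fixes A :: "complex mat"
  shows "i < dim_col A \<Longrightarrow> j < dim_row A \<Longrightarrow> mat_adjoint A $$ (i, j) = cnj (A $$ (j, i))"
  by (simp add: mat_adjoint_def mat_of_rows_index conjugate_complex_def)

lemma mat_adjoint_mult:
  fixes A B :: "complex mat"
  assumes "A \<in> carrier_mat n m" "B \<in> carrier_mat m l"
  shows "mat_adjoint (A * B) = mat_adjoint B * mat_adjoint A"
  using assms by (intro eq_matI) (auto simp: scalar_prod_def mult.commute)

lemma mat_adjoint_mat_adjoint [simp]: "mat_adjoint (mat_adjoint A) = (A :: complex mat)"
  by (intro eq_matI) auto

lemma mat_adjoint_one [simp]: "mat_adjoint (1\<^sub>m n) = (1\<^sub>m n :: complex mat)"
  by (intro eq_matI) auto

lemma bdiag_adjoint: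
  assumes "\<And>k. k < m \<Longrightarrow> F k \<in> carrier_mat N N"
  shows "bdiag m N (\<lambda>k. mat_adjoint (F k)) = mat_adjoint (bdiag m N F)"
proof (rule eq_matI)
  fix r s
  assume "r < dim_row (mat_adjoint (bdiag m N F))" "s < dim_col (mat_adjoint (bdiag m N F))"
  then have rs: "r < m * N" "s < m * N" by (simp_all add: bdiag_def)
  then have "F (r div N) \<in> carrier_mat N N" by (auto intro!: assms div_less_mult)
  with rs show "bdiag m N (\<lambda>k. mat_adjoint (F k)) $$ (r, s) = mat_adjoint (bdiag m N F) $$ (r, s)"
    by (auto simp: bdiag_def mod_less_mult)
qed (auto simp: bdiag_def)

lemma bdiag_one: "bdiag m N (\<lambda>_. 1\<^sub>m N) = 1\<^sub>m (m * N)"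
proof (rule eq_matI)
  fix r s assume "r < dim_row (1\<^sub>m (m * N) :: complex mat)" "s < dim_col (1\<^sub>m (m * N) :: complex mat)"
  then show "bdiag m N (\<lambda>_. 1\<^sub>m N) $$ (r, s) = 1\<^sub>m (m * N) $$ (r, s)"
    by (auto simp: bdiag_def mod_less_mult) (metis div_mult_mod_eq)
qed (auto simp: bdiag_def)

text \<open>Division by \<open>m * N\<close> is division by \<open>N\<close> and then by
  \<open>m\<close>, so block \<open>q\<close> inside block \<open>p\<close> becomes block
  \<open>p * m + q\<close>. This is what makes diagonal forms compose.\<close>

lemma bdiag_bdiag:
  "bdiag l (m * N) (\<lambda>p. bdiag m N (F p)) = bdiag (l * m) N (\<lambda>k. F (k div m) (k mod m))"
proof (rule eq_matI)
  fix r s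
  assume "r < dim_row (bdiag (l * m) N (\<lambda>k. F (k div m) (k mod m)))"
     "s < dim_col (bdiag (l * m) N (\<lambda>k. F (k div m) (k mod m)))"
  then have rs: "r < l * m * N" "s < l * m * N" by (simp_all add: bdiag_def)
  then have rs': "r < l * (m * N)" "s < l * (m * N)" by (simp_all add: mult.assoc)
  have d: "x div (m * N) = x div N div m" "x mod (m * N) div N = x div N mod m"
     "x mod (m * N) mod N = x mod N" for x
    using div_mult2_eq[of x N m] mod_mult2_eq[of x N m]
    by (cases "N = 0"; simp add: mult.commute)+
  have e: "r div N = s div N \<longleftrightarrow>
      r div N div m = s div N div m \<and> r div N mod m = s div N mod m"
    by (metis div_mult_mod_eq)
  show "bdiag l (m * N) (\<lambda>p. bdiag m N (F p)) $$ (r, s) =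
      bdiag (l * m) N (\<lambda>k. F (k div m) (k mod m)) $$ (r, s)"
    using rs rs' mod_less_mult[OF rs'(1)] mod_less_mult[OF rs'(2)] e
    by (auto simp: bdiag_def d)
qed (auto simp: bdiag_def)

subsection \<open>Matrix-valued functions on the unit interval\<close>

definition interval_maps :: "nat \<Rightarrow> (nat \<Rightarrow> real \<Rightarrow> real) \<Rightarrow> bool" where
  "interval_maps m \<xi> \<longleftrightarrow> (\<forall>k\<in>{1..m}. \<xi> k \<in> {0..1} \<rightarrow> {0..1} \<and> continuous_on {0..1} (\<xi> k))"

lemma interval_maps_Suc:
  assumes "interval_maps m \<xi>" "k < m"
  shows "\<And>t. t \<in> {0..1} \<Longrightarrow> \<xi> (Suc k) t \<in> {0..1}" "continuous_on {0..1} (\<xi> (Suc k))"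
  using assms unfolding interval_maps_def by (auto simp: Pi_iff)

lemma cont_mat_carrier: "f \<in> cont_mat k \<Longrightarrow> t \<in> {0..1} \<Longrightarrow> f t \<in> carrier_mat k k"
  by (auto simp: cont_mat_def)

lemma cont_mat_continuous:
  "f \<in> cont_mat k \<Longrightarrow> r < k \<Longrightarrow> s < k \<Longrightarrow> continuous_on {0..1} (\<lambda>t. f t $$ (r, s))"
  by (auto simp: cont_mat_def)

lemma cont_mat_extensional: "f \<in> cont_mat k \<Longrightarrow> f \<in> extensional {0..1}"
  by (auto simp: cont_mat_def PiE_iff)

lemma cont_matI:
  assumes "\<And>t. t \<in> {0..1} \<Longrightarrow> f t \<in> carrier_mat k k"
    and "\<And>r s. r < k \<Longrightarrow> s < k \<Longrightarrow> continuous_on {0..1} (\<lambda>t. f t $$ (r, s))"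
  shows "(\<lambda>t\<in>{0..1}. f t) \<in> cont_mat k"
proof -
  have "continuous_on {0..1} (\<lambda>t. (\<lambda>t\<in>{0..1}. f t) t $$ (r, s))" if "r < k" "s < k" for r s
    using assms(2)[OF that] by (rule iffD1[OF continuous_on_cong, rotated 2]) auto
  with assms(1) show ?thesis by (auto simp: cont_mat_def PiE_iff)
qed

section \<open>Pointwise operations preserve continuity\<close>

lemma cont_mat_cm_one: "cm_one k \<in> cont_mat k"
  unfolding cm_one_def by (rule cont_matI) auto

lemma cont_mat_cm_add:
  assumes "f \<in> cont_mat k" "g \<in> cont_mat k"
  shows "cm_add f g \<in> cont_mat k"
  unfolding cm_add_def
proof (rule cont_matI)
  fix r s assume rs: "r < k" "s < k"
  have "continuous_on {0..1} (\<lambda>t. f t $$ (r, s) + g t $$ (r, s))"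
    using assms rs by (intro continuous_intros cont_mat_continuous)
  also have "?this \<longleftrightarrow> continuous_on {0..1} (\<lambda>t. (f t + g t) $$ (r, s))"
  proof (rule continuous_on_cong)
    fix t :: real assume "t \<in> {0..1}"
    then have "g t \<in> carrier_mat k k" by (rule cont_mat_carrier[OF assms(2)])
    with rs show "f t $$ (r, s) + g t $$ (r, s) = (f t + g t) $$ (r, s)" by simp
  qed simp
  finally show "continuous_on {0..1} (\<lambda>t. (f t + g t) $$ (r, s))" .
qed (rule add_carrier_mat[OF assms(2)[THEN cont_mat_carrier]])

lemma cont_mat_cm_smult:
  assumes "f \<in> cont_mat k"
  shows "cm_smult z f \<in> cont_mat k"
  unfolding cm_smult_def
proof (rule cont_matI)
  fix r s assume rs: "r < k" "s < k"
  have "continuous_on {0..1} (\<lambda>t. z * f t $$ (r, s))"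
    using assms rs by (intro continuous_intros cont_mat_continuous)
  also have "?this \<longleftrightarrow> continuous_on {0..1} (\<lambda>t. (z \<cdot>\<^sub>m f t) $$ (r, s))"
  proof (rule continuous_on_cong)
    fix t :: real assume "t \<in> {0..1}"
    then have "f t \<in> carrier_mat k k" by (rule cont_mat_carrier[OF assms])
    with rs show "z * f t $$ (r, s) = (z \<cdot>\<^sub>m f t) $$ (r, s)" by simp
  qed simp
  finally show "continuous_on {0..1} (\<lambda>t. (z \<cdot>\<^sub>m f t) $$ (r, s))" .
qed (rule smult_carrier_mat[OF assms[THEN cont_mat_carrier]])

lemma cont_mat_cm_mult:
  assumes "f \<in> cont_mat k" "g \<in> cont_mat k"
  shows "cm_mult f g \<in> cont_mat k"
  unfolding cm_mult_def
proof (rule cont_matI)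
  fix r s assume rs: "r < k" "s < k"
  have "continuous_on {0..1} (\<lambda>t. \<Sum>i\<in>{0..<k}. f t $$ (r, i) * g t $$ (i, s))"
    using assms rs by (intro continuous_intros cont_mat_continuous) auto
  also have "?this \<longleftrightarrow> continuous_on {0..1} (\<lambda>t. (f t * g t) $$ (r, s))"
  proof (rule continuous_on_cong)
    fix t :: real assume "t \<in> {0..1}"
    then have "f t \<in> carrier_mat k k" "g t \<in> carrier_mat k k"
      using assms by (auto intro: cont_mat_carrier)
    with rs show "(\<Sum>i\<in>{0..<k}. f t $$ (r, i) * g t $$ (i, s)) = (f t * g t) $$ (r, s)"
      by (simp add: scalar_prod_def)
  qed simp
  finally show "continuous_on {0..1} (\<lambda>t. (f t * g t) $$ (r, s))" .
qed (rule mult_carrier_mat[OF assms[THEN cont_mat_carrier]]; assumption)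

lemma cont_mat_cm_star:
  assumes "f \<in> cont_mat k"
  shows "cm_star f \<in> cont_mat k"
  unfolding cm_star_def
proof (rule cont_matI)
  fix r s assume rs: "r < k" "s < k"
  have "continuous_on {0..1} (\<lambda>t. cnj (f t $$ (s, r)))"
    using assms rs by (intro continuous_intros cont_mat_continuous) auto
  also have "?this \<longleftrightarrow> continuous_on {0..1} (\<lambda>t. mat_adjoint (f t) $$ (r, s))"
  proof (rule continuous_on_cong)
    fix t :: real assume "t \<in> {0..1}"
    with assms have "f t \<in> carrier_mat k k" by (auto intro: cont_mat_carrier)
    with rs show "cnj (f t $$ (s, r)) = mat_adjoint (f t) $$ (r, s)" by simp
  qed simp
  finally show "continuous_on {0..1} (\<lambda>t. mat_adjoint (f t) $$ (r, s))" .
qed (rule mat_adjoint_carrier[OF assms[THEN cont_mat_carrier]])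

lemma diag_comp_eq_bdiag:
  assumes "f \<in> cont_mat N" "interval_maps m \<xi>"
  shows "diag_comp f m \<xi> = (\<lambda>t\<in>{0..1}. bdiag m N (\<lambda>k. f (\<xi> (Suc k) t)))"
  unfolding diag_comp_def
proof (rule restrict_ext)
  fix t :: real assume "t \<in> {0..1}"
  then have c: "\<And>k. k < m \<Longrightarrow> f (\<xi> (Suc k) t) \<in> carrier_mat N N"
    by (intro cont_mat_carrier[OF assms(1)] interval_maps_Suc(1)[OF assms(2)])
  have "map (\<lambda>k. f (\<xi> k t)) [1..<Suc m] = map (\<lambda>k. f (\<xi> (Suc k) t)) [0..<m]"
    unfolding One_nat_def map_Suc_upt[symmetric] map_map by (simp only: comp_def)
  then show "diag_block_mat (map (\<lambda>k. f (\<xi> k t)) [1..<Suc m]) =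
      bdiag m N (\<lambda>k. f (\<xi> (Suc k) t))"
    by (simp only: diag_block_mat_map_eq_bdiag[OF c])
qed

lemma cont_mat_diag_comp:
  assumes "f \<in> cont_mat N" "interval_maps m \<xi>"
  shows "diag_comp f m \<xi> \<in> cont_mat (m * N)"
  unfolding diag_comp_eq_bdiag[OF assms]
proof (rule cont_matI)
  fix r s assume rs: "r < m * N" "s < m * N"
  have q: "r div N < m" "r mod N < N" "s mod N < N"
    using rs by (auto intro: mod_less_mult div_less_mult)
  have "continuous_on {0..1} (\<lambda>t. f (\<xi> (Suc (r div N)) t) $$ (r mod N, s mod N))"
    by (rule continuous_on_compose2[OF cont_mat_continuous[OF assms(1) q(2,3)]
        interval_maps_Suc(2)[OF assms(2) q(1)]]) (intro image_subsetI interval_maps_Suc(1)[OF assms(2) q(1)])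
  moreover have "bdiag m N (\<lambda>k. f (\<xi> (Suc k) t)) $$ (r, s) = (if r div N = s div N
      then f (\<xi> (Suc (r div N)) t) $$ (r mod N, s mod N) else 0)" for t
    using rs by (simp add: bdiag_def)
  ultimately show "continuous_on {0..1} (\<lambda>t. bdiag m N (\<lambda>k. f (\<xi> (Suc k) t)) $$ (r, s))"
    by (cases "r div N = s div N") simp_all
qed auto

section \<open>Evaluation along interval maps commutes with the pointwise operations\<close>

context
  fixes N m :: nat and \<xi> :: "nat \<Rightarrow> real \<Rightarrow> real"
  assumes \<xi>: "interval_maps m \<xi>"
begin

lemma diag_comp_apply:
  "f \<in> cont_mat N \<Longrightarrow> t \<in> {0..1} \<Longrightarrow> diag_comp f m \<xi> t = bdiag m N (\<lambda>k. f (\<xi> (Suc k) t))"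
  by (simp add: diag_comp_eq_bdiag[OF _ \<xi>, of f N])

lemma diag_comp_block_carrier:
  "f \<in> cont_mat N \<Longrightarrow> t \<in> {0..1} \<Longrightarrow> k < m \<Longrightarrow> f (\<xi> (Suc k) t) \<in> carrier_mat N N"
  by (intro cont_mat_carrier interval_maps_Suc(1)[OF \<xi>])

lemma diag_comp_cm_add:
  assumes "f \<in> cont_mat N" "g \<in> cont_mat N" "cm_add f g \<in> cont_mat N" "t \<in> {0..1}"
  shows "diag_comp (cm_add f g) m \<xi> t = diag_comp f m \<xi> t + diag_comp g m \<xi> t"
proof -
  have "bdiag m N (\<lambda>k. cm_add f g (\<xi> (Suc k) t)) = bdiag m N (\<lambda>k. f (\<xi> (Suc k) t) + g (\<xi> (Suc k) t))"
    by (rule bdiag_cong)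
      (simp only: cm_add_def restrict_apply'[OF interval_maps_Suc(1)[OF \<xi> _ assms(4)]])
  also have "\<dots> = bdiag m N (\<lambda>k. f (\<xi> (Suc k) t)) + bdiag m N (\<lambda>k. g (\<xi> (Suc k) t))"
    by (rule bdiag_add) (intro diag_comp_block_carrier assms; assumption)+
  finally show ?thesis
    using diag_comp_apply[OF assms(1) assms(4)]
      diag_comp_apply[OF assms(2) assms(4)]
      diag_comp_apply[OF assms(3) assms(4)] by simp
qed

lemma diag_comp_cm_smult:
  assumes "f \<in> cont_mat N" "cm_smult z f \<in> cont_mat N" "t \<in> {0..1}"
  shows "diag_comp (cm_smult z f) m \<xi> t = z \<cdot>\<^sub>m diag_comp f m \<xi> t"
proof -
  have "bdiag m N (\<lambda>k. cm_smult z f (\<xi> (Suc k) t)) = bdiag m N (\<lambda>k. z \<cdot>\<^sub>m f (\<xi> (Suc k) t))"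
    by (rule bdiag_cong)
      (simp only: cm_smult_def restrict_apply'[OF interval_maps_Suc(1)[OF \<xi> _ assms(3)]])
  also have "\<dots> = z \<cdot>\<^sub>m bdiag m N (\<lambda>k. f (\<xi> (Suc k) t))"
    by (rule bdiag_smult) (intro diag_comp_block_carrier assms; assumption)+
  finally show ?thesis
    using diag_comp_apply[OF assms(1) assms(3)]
      diag_comp_apply[OF assms(2) assms(3)] by simp
qed

lemma diag_comp_cm_mult:
  assumes "f \<in> cont_mat N" "g \<in> cont_mat N" "t \<in> {0..1}"
  shows "diag_comp (cm_mult f g) m \<xi> t = diag_comp f m \<xi> t * diag_comp g m \<xi> t"
proof -
  have "bdiag m N (\<lambda>k. cm_mult f g (\<xi> (Suc k) t)) = bdiag m N (\<lambda>k. f (\<xi> (Suc k) t) * g (\<xi> (Suc k) t))"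
    by (rule bdiag_cong)
      (simp only: cm_mult_def restrict_apply'[OF interval_maps_Suc(1)[OF \<xi> _ assms(3)]])
  also have "\<dots> = bdiag m N (\<lambda>k. f (\<xi> (Suc k) t)) * bdiag m N (\<lambda>k. g (\<xi> (Suc k) t))"
    by (rule bdiag_mult[symmetric]) (intro diag_comp_block_carrier assms; assumption)+
  finally show ?thesis
    using diag_comp_apply[OF assms(1) assms(3)]
      diag_comp_apply[OF assms(2) assms(3)]
      diag_comp_apply[OF cont_mat_cm_mult[OF assms(1,2)] assms(3)] by simp
qed

lemma diag_comp_cm_star:
  assumes "f \<in> cont_mat N" "t \<in> {0..1}"
  shows "diag_comp (cm_star f) m \<xi> t = mat_adjoint (diag_comp f m \<xi> t)"
proof -
  have "bdiag m N (\<lambda>k. cm_star f (\<xi> (Suc k) t)) = bdiag m N (\<lambda>k. mat_adjoint (f (\<xi> (Suc k) t)))"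
    by (rule bdiag_cong)
      (simp only: cm_star_def restrict_apply'[OF interval_maps_Suc(1)[OF \<xi> _ assms(2)]])
  also have "\<dots> = mat_adjoint (bdiag m N (\<lambda>k. f (\<xi> (Suc k) t)))"
    by (rule bdiag_adjoint) (intro diag_comp_block_carrier assms; assumption)+
  finally show ?thesis
    using diag_comp_apply[OF assms(1) assms(2)]
      diag_comp_apply[OF cont_mat_cm_star[OF assms(1)] assms(2)] by simp
qed

lemma diag_comp_cm_one:
  assumes "t \<in> {0..1}"
  shows "diag_comp (cm_one N) m \<xi> t = 1\<^sub>m (m * N)"
  unfolding diag_comp_apply[OF cont_mat_cm_one assms] bdiag_one[symmetric]
  by (rule bdiag_cong)
    (simp only: cm_one_def restrict_apply'[OF interval_maps_Suc(1)[OF \<xi> _ assms]])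

end

text \<open>A one-sided inverse of a square matrix is two-sided, so one of the two unitarity
  equations is enough.\<close>

lemma cm_unitaryI:
  assumes "u \<in> cont_mat k" "\<And>t. t \<in> {0..1} \<Longrightarrow> u t * mat_adjoint (u t) = 1\<^sub>m k"
  shows "cm_unitary k u"
proof -
  have "mat_adjoint (u t) * u t = 1\<^sub>m k" if "t \<in> {0..1}" for t
    using assms cont_mat_carrier[OF assms(1) that] that
    by (intro mat_mult_left_right_inverse[of "u t"]) auto
  with assms show ?thesis
    by (auto simp: cm_unitary_def cm_mult_def cm_star_def cm_one_def intro!: restrict_ext)
qed

lemma cm_unitaryD:
  assumes "cm_unitary k u"
  shows "u \<in> cont_mat k"
    and "t \<in> {0..1} \<Longrightarrow> u t * mat_adjoint (u t) = 1\<^sub>m k"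
    and "t \<in> {0..1} \<Longrightarrow> mat_adjoint (u t) * u t = 1\<^sub>m k"
proof -
  show "u \<in> cont_mat k" using assms by (simp add: cm_unitary_def)
  have "cm_mult u (cm_star u) t = cm_one k t" "cm_mult (cm_star u) u t = cm_one k t"
    using assms by (simp_all add: cm_unitary_def)
  then show "t \<in> {0..1} \<Longrightarrow> u t * mat_adjoint (u t) = 1\<^sub>m k"
    "t \<in> {0..1} \<Longrightarrow> mat_adjoint (u t) * u t = 1\<^sub>m k"
    by (simp_all add: cm_mult_def cm_star_def cm_one_def)
qed

lemma unitary_mult:
  fixes U V :: "complex mat"
  assumes "U \<in> carrier_mat k k" "V \<in> carrier_mat k k"
    "U * mat_adjoint U = 1\<^sub>m k" "V * mat_adjoint V = 1\<^sub>m k"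
  shows "U * V * mat_adjoint (U * V) = 1\<^sub>m k"
proof -
  have "U * V * mat_adjoint (U * V) = U * (V * mat_adjoint V) * mat_adjoint U"
    using assms(1,2) by (simp add: mat_adjoint_mult[of _ k k _ k]
        assoc_mult_mat[of _ k k _ k _ k] mult_carrier_mat[of _ k k _ k])
  with assms show ?thesis by simp
qed

lemma cm_unitary_cm_mult:
  assumes "cm_unitary k u" "cm_unitary k v"
  shows "cm_unitary k (cm_mult u v)"
proof (rule cm_unitaryI)
  fix t :: real assume t: "t \<in> {0..1}"
  then show "cm_mult u v t * mat_adjoint (cm_mult u v t) = 1\<^sub>m k"
    using unitary_mult[OF assms[THEN cm_unitaryD(1), THEN cont_mat_carrier, OF t]
        assms[THEN cm_unitaryD(2), OF t]] by (simp add: cm_mult_def)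
qed (rule cont_mat_cm_mult[OF assms[THEN cm_unitaryD(1)]])

text \<open>\<open>diag_comp\<close> respects products, adjoints and the unit, so it carries
  unitaries to unitaries.\<close>

lemma cm_unitary_diag_comp:
  assumes "cm_unitary N u" "interval_maps m \<xi>"
  shows "cm_unitary (m * N) (diag_comp u m \<xi>)"
proof (rule cm_unitaryI)
  note u = cm_unitaryD(1)[OF assms(1)]
  show "diag_comp u m \<xi> \<in> cont_mat (m * N)" using u assms(2) by (rule cont_mat_diag_comp)
  fix t :: real assume t: "t \<in> {0..1}"
  have "diag_comp u m \<xi> t * mat_adjoint (diag_comp u m \<xi> t) = diag_comp (cm_mult u (cm_star u)) m \<xi> t"
    by (simp add: diag_comp_cm_mult[OF assms(2) u cont_mat_cm_star[OF u] t]
        diag_comp_cm_star[OF assms(2) u t])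
  also have "\<dots> = 1\<^sub>m (m * N)"
    using assms t diag_comp_cm_one[OF assms(2) t] by (simp add: cm_unitary_def)
  finally show "diag_comp u m \<xi> t * mat_adjoint (diag_comp u m \<xi> t) = 1\<^sub>m (m * N)" .
qed

subsection \<open>Maps of diagonal form\<close>

text \<open>A Lipschitz bound stands in place of the bound on
  \<open>\<bar>\<xi> k x - \<xi> k y\<bar>\<close> in the theorem, because Lipschitz constants
  multiply under composition while bounds on the oscillation do not. \<open>N\<close> and
  \<open>M\<close> are the matrix sizes of source and target.\<close>

definition diag_form ::
  "real \<Rightarrow> nat \<Rightarrow> nat \<Rightarrow> (real \<Rightarrow> complex mat) set \<Rightarrow>
   ((real \<Rightarrow> complex mat) \<Rightarrow> real \<Rightarrow> complex mat) \<Rightarrow> bool" where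
  "diag_form L N M A \<phi> \<longleftrightarrow> (\<exists>m u \<xi>. m * N = M \<and> cm_unitary M u \<and> interval_maps m \<xi> \<and>
     (\<forall>f\<in>A. \<phi> f = cm_mult (cm_mult u (diag_comp f m \<xi>)) (cm_star u)) \<and>
     (\<forall>k\<in>{1..m}. \<forall>x\<in>{0..1}. \<forall>y\<in>{0..1}. \<bar>\<xi> k x - \<xi> k y\<bar> \<le> L * \<bar>x - y\<bar>) \<and>
     (\<Union>k\<in>{1..m}. \<xi> k ` {0..1}) = {0..1})"

lemma conj_mult:
  fixes U X Y :: "complex mat"
  assumes "U \<in> carrier_mat k k" "X \<in> carrier_mat k k" "Y \<in> carrier_mat k k"
    "mat_adjoint U * U = 1\<^sub>m k"
  shows "U * (X * Y) * mat_adjoint U = (U * X * mat_adjoint U) * (U * Y * mat_adjoint U)"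
proof -
  have "(U * X * mat_adjoint U) * (U * Y * mat_adjoint U) =
      U * X * (mat_adjoint U * U) * Y * mat_adjoint U"
    using assms(1-3) by (simp add: assoc_mult_mat[of _ k k _ k _ k] mult_carrier_mat[of _ k k _ k])
  also have "\<dots> = U * (X * Y) * mat_adjoint U"
    using assms by (simp add: assoc_mult_mat[of _ k k _ k _ k] mult_carrier_mat[of _ k k _ k])
  finally show ?thesis by simp
qed

text \<open>Conjugation by a unitary and evaluation along \<open>\<xi>\<close> both respect the
  operations. The formula for \<open>\<phi>\<close> is given on \<open>A\<close> only, so the
  closure of \<open>A\<close> is what allows it to be applied to sums, multiples, products and
  adjoints.\<close>

lemma star_hom_diag_form:
  assumes form: "diag_form L N M A \<phi>" and "\<phi> \<in> A \<rightarrow> B" "A \<subseteq> cont_mat N"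
    and add: "\<And>f g. f \<in> A \<Longrightarrow> g \<in> A \<Longrightarrow> cm_add f g \<in> A"
    and smult: "\<And>f z. f \<in> A \<Longrightarrow> cm_smult z f \<in> A"
    and mult: "\<And>f g. f \<in> A \<Longrightarrow> g \<in> A \<Longrightarrow> cm_mult f g \<in> A"
    and star: "\<And>f. f \<in> A \<Longrightarrow> cm_star f \<in> A"
  shows "star_hom A B \<phi>"
proof -
  obtain m u \<xi> where M: "m * N = M" and u: "cm_unitary M u" and \<xi>: "interval_maps m \<xi>"
    and \<phi>: "\<And>f. f \<in> A \<Longrightarrow> \<phi> f = cm_mult (cm_mult u (diag_comp f m \<xi>)) (cm_star u)"
    using form by (auto simp: diag_form_def)
  have ap: "\<phi> f = (\<lambda>t\<in>{0..1}. u t * diag_comp f m \<xi> t * mat_adjoint (u t))" if "f \<in> A" for f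
    using \<phi>[OF that] by (auto simp: cm_mult_def cm_star_def)
  have U: "u t \<in> carrier_mat M M" if "t \<in> {0..1}" for t
    using cont_mat_carrier[OF cm_unitaryD(1)[OF u] that] .
  have D: "diag_comp f m \<xi> t \<in> carrier_mat M M" if "f \<in> A" "t \<in> {0..1}" for f t
    using cont_mat_carrier[OF cont_mat_diag_comp[OF _ \<xi>]] that assms(3) M by blast
  have c: "f \<in> cont_mat N" if "f \<in> A" for f using that assms(3) by auto
  show ?thesis
    unfolding star_hom_def
  proof (intro conjI ballI allI)
    show "\<phi> \<in> A \<rightarrow> B" by fact
  next
    fix f g assume fg: "f \<in> A" "g \<in> A"
    show "\<phi> (cm_add f g) = cm_add (\<phi> f) (\<phi> g)"
      unfolding ap[OF add[OF fg]] cm_add_def[of "\<phi> f"]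
    proof (rule restrict_ext)
      fix t :: real assume t: "t \<in> {0..1}"
      note [simp] = U[OF t] D[OF fg(1) t] D[OF fg(2) t]
      have "u t * (diag_comp f m \<xi> t + diag_comp g m \<xi> t) * mat_adjoint (u t) =
        u t * diag_comp f m \<xi> t * mat_adjoint (u t) + u t * diag_comp g m \<xi> t * mat_adjoint (u t)"
        by (simp add: mult_add_distrib_mat[of _ M M _ M] add_mult_distrib_mat[of _ M M _ _ M]
            mult_carrier_mat[of _ M M _ M])
      then show "u t * diag_comp (cm_add f g) m \<xi> t * mat_adjoint (u t) = \<phi> f t + \<phi> g t"
        unfolding diag_comp_cm_add[OF \<xi> c[OF fg(1)] c[OF fg(2)] c[OF add[OF fg]] t]
        using t by (simp add: ap fg)
    qed
    show "\<phi> (cm_mult f g) = cm_mult (\<phi> f) (\<phi> g)"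
      unfolding ap[OF mult[OF fg]] cm_mult_def[of "\<phi> f"]
    proof (rule restrict_ext)
      fix t :: real assume t: "t \<in> {0..1}"
      show "u t * diag_comp (cm_mult f g) m \<xi> t * mat_adjoint (u t) = \<phi> f t * \<phi> g t"
        unfolding diag_comp_cm_mult[OF \<xi> c[OF fg(1)] c[OF fg(2)] t]
          conj_mult[OF U[OF t] D[OF fg(1) t] D[OF fg(2) t] cm_unitaryD(3)[OF u t]]
        using t by (simp add: ap fg)
    qed
  next
    fix z f assume f: "f \<in> A"
    show "\<phi> (cm_smult z f) = cm_smult z (\<phi> f)"
      unfolding ap[OF smult[OF f]] cm_smult_def[of z "\<phi> f"]
    proof (rule restrict_ext)
      fix t :: real assume t: "t \<in> {0..1}"
      note [simp] = U[OF t] D[OF f t]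
      have "u t * (z \<cdot>\<^sub>m diag_comp f m \<xi> t) * mat_adjoint (u t) =
        z \<cdot>\<^sub>m (u t * diag_comp f m \<xi> t * mat_adjoint (u t))"
        by (simp add: mult_smult_distrib[of _ M M _ M] mult_smult_assoc_mat[of _ M M _ M]
            mult_carrier_mat[of _ M M _ M])
      then show "u t * diag_comp (cm_smult z f) m \<xi> t * mat_adjoint (u t) = z \<cdot>\<^sub>m \<phi> f t"
        unfolding diag_comp_cm_smult[OF \<xi> c[OF f] c[OF smult[OF f]] t]
        using t by (simp add: ap f)
    qed
  next
    fix f assume f: "f \<in> A"
    show "\<phi> (cm_star f) = cm_star (\<phi> f)"
      unfolding ap[OF star[OF f]] cm_star_def[of "\<phi> f"]
    proof (rule restrict_ext)
      fix t :: real assume t: "t \<in> {0..1}"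
      note [simp] = U[OF t] D[OF f t]
      have "u t * mat_adjoint (diag_comp f m \<xi> t) * mat_adjoint (u t) =
        mat_adjoint (u t * diag_comp f m \<xi> t * mat_adjoint (u t))"
        by (simp add: mat_adjoint_mult[of _ M M _ M] assoc_mult_mat[of _ M M _ M _ M]
            mult_carrier_mat[of _ M M _ M])
      then show "u t * diag_comp (cm_star f) m \<xi> t * mat_adjoint (u t) = mat_adjoint (\<phi> f t)"
        unfolding diag_comp_cm_star[OF \<xi> c[OF f] t]
        using t by (simp add: ap f)
    qed
  qed
qed

lemma star_hom_id: "star_hom A A id"
  by (simp add: star_hom_def)

lemma star_hom_comp: "star_hom A B \<phi> \<Longrightarrow> star_hom B C \<psi> \<Longrightarrow> star_hom A C (\<psi> \<circ> \<phi>)"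
  by (auto simp: star_hom_def Pi_iff)

text \<open>The number \<open>k - 1 = p * m + q\<close> encodes the pair of
  \<open>\<eta> (Suc p)\<close> and \<open>\<xi> (Suc q)\<close>, in the order in which
  \<open>bdiag_bdiag\<close> flattens nested blocks.\<close>

lemma diag_comp_diag_comp:
  assumes f: "f \<in> cont_mat N" and \<xi>: "interval_maps m \<xi>" and \<eta>: "interval_maps l \<eta>"
  defines "\<zeta> \<equiv> \<lambda>k t. \<xi> (Suc ((k - 1) mod m)) (\<eta> (Suc ((k - 1) div m)) t)"
  shows "interval_maps (l * m) \<zeta>"
    and "diag_comp (diag_comp f m \<xi>) l \<eta> = diag_comp f (l * m) \<zeta>"
proof -
  show \<zeta>: "interval_maps (l * m) \<zeta>"
    unfolding interval_maps_def
  proof (intro ballI conjI)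
    fix k assume "k \<in> {1..l * m}"
    then have k: "k - 1 < l * m" by auto
    note q = div_less_mult[OF k] mod_less_mult[OF k]
    show "\<zeta> k \<in> {0..1} \<rightarrow> {0..1}"
      unfolding \<zeta>_def by (intro Pi_I interval_maps_Suc(1)[OF \<xi>] interval_maps_Suc(1)[OF \<eta>] q)
    show "continuous_on {0..1} (\<zeta> k)"
      unfolding \<zeta>_def
      by (rule continuous_on_compose2[OF interval_maps_Suc(2)[OF \<xi> q(2)] interval_maps_Suc(2)[OF \<eta> q(1)]])
        (intro image_subsetI interval_maps_Suc(1)[OF \<eta> q(1)])
  qed
  show "diag_comp (diag_comp f m \<xi>) l \<eta> = diag_comp f (l * m) \<zeta>"
    unfolding diag_comp_eq_bdiag[OF cont_mat_diag_comp[OF f \<xi>] \<eta>] diag_comp_eq_bdiag[OF f \<zeta>]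
  proof (rule restrict_ext)
    fix t :: real assume t: "t \<in> {0..1}"
    have "bdiag l (m * N) (\<lambda>k. diag_comp f m \<xi> (\<eta> (Suc k) t)) =
        bdiag l (m * N) (\<lambda>p. bdiag m N (\<lambda>k. f (\<xi> (Suc k) (\<eta> (Suc p) t))))"
      by (intro bdiag_cong diag_comp_apply[OF \<xi> f] interval_maps_Suc(1)[OF \<eta> _ t])
    also have "\<dots> = bdiag (l * m) N (\<lambda>k. f (\<zeta> (Suc k) t))"
      unfolding bdiag_bdiag by (simp add: \<zeta>_def)
    finally show "bdiag l (m * N) (\<lambda>k. diag_comp f m \<xi> (\<eta> (Suc k) t)) =
      bdiag (l * m) N (\<lambda>k. f (\<zeta> (Suc k) t))" .
  qed
qed

text \<open>Since \<open>diag_comp\<close> along \<open>\<eta>\<close> is multiplicative, it turns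
  the conjugation by \<open>u\<close> inside \<open>\<phi>\<close> into conjugation by
  \<open>diag_comp u l \<eta>\<close>. The latter is absorbed into the outer unitary
  \<open>v\<close>.\<close>

lemma diag_form_comp:
  assumes \<phi>: "diag_form K N M A \<phi>" and \<psi>: "diag_form L M P B \<psi>" and "\<phi> \<in> A \<rightarrow> B"
    and "A \<subseteq> cont_mat N" and L: "0 \<le> K"
  shows "diag_form (K * L) N P A (\<psi> \<circ> \<phi>)"
proof -
  obtain m u \<xi> where M: "m * N = M" and u: "cm_unitary M u" and \<xi>: "interval_maps m \<xi>"
    and \<phi>_eq: "\<And>f. f \<in> A \<Longrightarrow> \<phi> f = cm_mult (cm_mult u (diag_comp f m \<xi>)) (cm_star u)"
    and lip\<xi>: "\<And>k x y. k \<in> {1..m} \<Longrightarrow> x \<in> {0..1} \<Longrightarrow> y \<in> {0..1} \<Longrightarrow> \<bar>\<xi> k x - \<xi> k y\<bar> \<le> K * \<bar>x - y\<bar>"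
    and sur\<xi>: "(\<Union>k\<in>{1..m}. \<xi> k ` {0..1}) = {0..1}"
    using \<phi> unfolding diag_form_def by metis
  obtain l v \<eta> where P: "l * M = P" and v: "cm_unitary P v" and \<eta>: "interval_maps l \<eta>"
    and \<psi>_eq: "\<And>f. f \<in> B \<Longrightarrow> \<psi> f = cm_mult (cm_mult v (diag_comp f l \<eta>)) (cm_star v)"
    and lip\<eta>: "\<And>k x y. k \<in> {1..l} \<Longrightarrow> x \<in> {0..1} \<Longrightarrow> y \<in> {0..1} \<Longrightarrow> \<bar>\<eta> k x - \<eta> k y\<bar> \<le> L * \<bar>x - y\<bar>"
    and sur\<eta>: "(\<Union>k\<in>{1..l}. \<eta> k ` {0..1}) = {0..1}"
    using \<psi> unfolding diag_form_def by metis
  define \<zeta> where "\<zeta> = (\<lambda>k t. \<xi> (Suc ((k - 1) mod m)) (\<eta> (Suc ((k - 1) div m)) t))"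
  define w where "w = cm_mult v (diag_comp u l \<eta>)"
  have w': "cm_unitary P (diag_comp u l \<eta>)"
    using cm_unitary_diag_comp[OF u \<eta>] P by simp
  have w: "cm_unitary P w" unfolding w_def by (rule cm_unitary_cm_mult[OF v w'])
  have idx: "(k - 1) div m < l \<and> (k - 1) mod m < m" if "k \<in> {1..l * m}" for k
    using that div_less_mult[of "k - 1" l m] mod_less_mult[of "k - 1" l m] by auto
  have \<eta>01: "\<eta> k x \<in> {0..1}" if "k \<in> {1..l}" "x \<in> {0..1}" for k x
    using sur\<eta> that by blast
  have eq: "(\<psi> \<circ> \<phi>) f = cm_mult (cm_mult w (diag_comp f (l * m) \<zeta>)) (cm_star w)" if "f \<in> A" for f
  proof -
    have f: "f \<in> cont_mat N" using that assms(4) by auto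
    have d: "diag_comp f m \<xi> \<in> cont_mat M" using cont_mat_diag_comp[OF f \<xi>] M by simp
    note u' = cm_unitaryD(1)[OF u]
    have "(\<psi> \<circ> \<phi>) f = cm_mult (cm_mult v (diag_comp (\<phi> f) l \<eta>)) (cm_star v)"
      using \<psi>_eq[of "\<phi> f"] that assms(3) by auto
    also have "\<dots> = cm_mult (cm_mult w (diag_comp (diag_comp f m \<xi>) l \<eta>)) (cm_star w)"
      unfolding cm_mult_def[of "cm_mult _ _"]
    proof (rule restrict_ext)
      fix t :: real assume t: "t \<in> {0..1}"
      let ?D = "diag_comp (diag_comp f m \<xi>) l \<eta> t" and ?U = "diag_comp u l \<eta> t"
      have D: "?D \<in> carrier_mat P P" and V: "v t \<in> carrier_mat P P" and U: "?U \<in> carrier_mat P P"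
        using cont_mat_carrier[OF cont_mat_diag_comp[OF d \<eta>] t] P
          cont_mat_carrier[OF cm_unitaryD(1)[OF v] t] cont_mat_carrier[OF cm_unitaryD(1)[OF w'] t]
        by simp_all
      have \<phi>f: "diag_comp (\<phi> f) l \<eta> t = ?U * ?D * mat_adjoint ?U"
        unfolding \<phi>_eq[OF that]
          diag_comp_cm_mult[OF \<eta> cont_mat_cm_mult[OF u' d] cont_mat_cm_star[OF u'] t]
          diag_comp_cm_mult[OF \<eta> u' d t] diag_comp_cm_star[OF \<eta> u' t] ..
      show "cm_mult v (diag_comp (\<phi> f) l \<eta>) t * cm_star v t = cm_mult w (diag_comp (diag_comp f m \<xi>) l \<eta>) t * cm_star w t"
        using t D V U
        by (simp add: w_def cm_mult_def cm_star_def \<phi>f mat_adjoint_mult[of _ P P _ P]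
            assoc_mult_mat[of _ P P _ P _ P] mult_carrier_mat[of _ P P _ P])
    qed
    also have "diag_comp (diag_comp f m \<xi>) l \<eta> = diag_comp f (l * m) \<zeta>"
      unfolding \<zeta>_def using diag_comp_diag_comp(2)[OF f \<xi> \<eta>] .
    finally show ?thesis .
  qed
  have lip: "\<bar>\<zeta> k x - \<zeta> k y\<bar> \<le> K * L * \<bar>x - y\<bar>"
    if k: "k \<in> {1..l * m}" and xy: "x \<in> {0..1}" "y \<in> {0..1}" for k x y
  proof -
    let ?p = "Suc ((k - 1) div m)"
    have p: "?p \<in> {1..l}" and q: "Suc ((k - 1) mod m) \<in> {1..m}" using idx[OF k] by auto
    have "\<bar>\<zeta> k x - \<zeta> k y\<bar> \<le> K * \<bar>\<eta> ?p x - \<eta> ?p y\<bar>"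
      unfolding \<zeta>_def by (rule lip\<xi>[OF q \<eta>01[OF p xy(1)] \<eta>01[OF p xy(2)]])
    also have "\<dots> \<le> K * (L * \<bar>x - y\<bar>)"
      by (rule mult_left_mono[OF lip\<eta>[OF p xy] L])
    finally show ?thesis by (simp add: mult.assoc)
  qed
  \<comment> \<open>The constant function one serves as the \<open>f\<close> of
    \<open>diag_comp_diag_comp\<close>.\<close>
  have \<zeta>: "interval_maps (l * m) \<zeta>" unfolding \<zeta>_def
    using diag_comp_diag_comp(1)[OF _ \<xi> \<eta>] cont_mat_cm_one by blast
  have sur: "(\<Union>k\<in>{1..l * m}. \<zeta> k ` {0..1}) = {0..1}"
  proof
    show "(\<Union>k\<in>{1..l * m}. \<zeta> k ` {0..1}) \<subseteq> {0..1}"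
      using \<zeta> unfolding interval_maps_def by blast
    show "{0..1} \<subseteq> (\<Union>k\<in>{1..l * m}. \<zeta> k ` {0..1})"
    proof
      fix z :: real assume "z \<in> {0..1}"
      then obtain q y where q: "q \<in> {1..m}" "y \<in> {0..1}" "z = \<xi> q y" using sur\<xi> by blast
      then obtain p x where p: "p \<in> {1..l}" "x \<in> {0..1}" "y = \<eta> p x" using sur\<eta> by blast
      obtain p' q' where p': "p = Suc p'" and q': "q = Suc q'" "q' < m"
        using p(1) q(1) by (cases p; cases q) auto
      let ?k = "Suc (p' * m + q')"
      have "p' * m + q' < Suc p' * m" using q' by simp
      also have "\<dots> \<le> l * m" using p(1) p' by (intro mult_le_mono1) auto
      finally have "?k \<in> {1..l * m}" by auto
      moreover have "\<zeta> ?k x = z" using p q p' q' by (simp add: \<zeta>_def)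
      ultimately show "z \<in> (\<Union>k\<in>{1..l * m}. \<zeta> k ` {0..1})" using p(2) by blast
    qed
  qed
  have "l * m * N = P" using M P by (simp add: mult.assoc)
  with w \<zeta> eq lip sur show ?thesis unfolding diag_form_def by blast
qed

lemma diag_form_id:
  assumes "A \<subseteq> cont_mat N"
  shows "diag_form 1 N N A id"
proof -
  have \<xi>: "interval_maps 1 (\<lambda>_ x. x)" by (auto simp: interval_maps_def)
  have "id f = cm_mult (cm_mult (cm_one N) (diag_comp f 1 (\<lambda>_ x. x))) (cm_star (cm_one N))"
    if "f \<in> A" for f
  proof
    fix t
    from that assms have f: "f \<in> cont_mat N" by auto
    show "id f t = cm_mult (cm_mult (cm_one N) (diag_comp f 1 (\<lambda>_ x. x))) (cm_star (cm_one N)) t"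
    proof (cases "t \<in> {0..1}")
      case True
      with left_mult_one_mat[OF cont_mat_carrier[OF f True]]
        right_mult_one_mat[OF cont_mat_carrier[OF f True]]
      show ?thesis by (simp add: cm_mult_def cm_one_def cm_star_def diag_comp_def del: diag_block_mat.simps)
    next
      \<comment> \<open>Off the unit interval both sides are \<open>undefined\<close>, by
        extensionality.\<close>
      case False
      with cont_mat_extensional[OF f] show ?thesis
        by (auto simp: cm_mult_def extensional_def)
    qed
  qed
  moreover have "cm_unitary N (cm_one N)"
    by (rule cm_unitaryI[OF cont_mat_cm_one]) (simp add: cm_one_def)
  ultimately show ?thesis
    unfolding diag_form_def using \<xi>
    by (intro exI[of _ 1] exI[of _ "cm_one N"] exI[of _ "\<lambda>_ x. x"]) auto
qed

subsection \<open>Paths of unitaries\<close>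

text \<open>With the start fixed at the identity, the possible end points are closed under products,
  by pointwise multiplication of paths.\<close>

definition unitary_path :: "nat \<Rightarrow> complex mat \<Rightarrow> bool" where
  "unitary_path N P \<longleftrightarrow> (\<exists>u. cm_unitary N u \<and> u 0 = 1\<^sub>m N \<and> u 1 = P)"

lemma unitary_path_one: "unitary_path N (1\<^sub>m N)"
  unfolding unitary_path_def
  by (intro exI[of _ "cm_one N"] conjI cm_unitaryI[OF cont_mat_cm_one]) (simp_all add: cm_one_def)

lemma unitary_path_mult:
  assumes "unitary_path N P" "unitary_path N Q"
  shows "unitary_path N (P * Q)"
proof -
  obtain u v where "cm_unitary N u" "u 0 = 1\<^sub>m N" "u 1 = P" "cm_unitary N v" "v 0 = 1\<^sub>m N" "v 1 = Q"
    using assms by (auto simp: unitary_path_def)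
  then show ?thesis
    unfolding unitary_path_def
    by (intro exI[of _ "cm_mult u v"]) (simp add: cm_unitary_cm_mult, simp add: cm_mult_def)
qed

text \<open>With \<open>w = exp (\<i> \<pi> t)\<close>, the path is \<open>exp (\<i> \<pi> t p)\<close> for the spectral
  projection \<open>p = (1 - S) / 2\<close> of \<open>S\<close>.\<close>

lemma unitary_path_symmetry:
  assumes S: "S \<in> carrier_mat N N" and adj: "mat_adjoint S = S" and sq: "S * S = 1\<^sub>m N"
  shows "unitary_path N S"
proof -
  define w where "w t = cis (pi * t)" for t :: real
  define \<alpha> where "\<alpha> t = (1 + w t) / 2" for t
  define \<beta> where "\<beta> t = (1 - w t) / 2" for t
  define u where "u = (\<lambda>t\<in>{0..1}. \<alpha> t \<cdot>\<^sub>m 1\<^sub>m N + \<beta> t \<cdot>\<^sub>m S)"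
  have w: "w t * cnj (w t) = 1" for t
    by (simp add: w_def cis_cnj cis_mult)
  \<comment> \<open>These are the coefficients of the identity and of \<open>S\<close> in
    \<open>u t * mat_adjoint (u t)\<close>, because \<open>S\<close> is self-adjoint with square
    one.\<close>
  have 1: "\<alpha> t * cnj (\<alpha> t) + \<beta> t * cnj (\<beta> t) = 1"
    and 2: "\<alpha> t * cnj (\<beta> t) + \<beta> t * cnj (\<alpha> t) = 0" for t
    using w[of t] by (simp_all add: \<alpha>_def \<beta>_def field_simps)
  have "u \<in> cont_mat N"
    unfolding u_def
  proof (rule cont_matI)
    fix r s assume rs: "r < N" "s < N"
    have "continuous_on {0..1} (\<lambda>t. \<alpha> t * 1\<^sub>m N $$ (r, s) + \<beta> t * S $$ (r, s))"
      unfolding \<alpha>_def \<beta>_def w_def by (intro continuous_intros) auto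
    then show "continuous_on {0..1} (\<lambda>t. (\<alpha> t \<cdot>\<^sub>m 1\<^sub>m N + \<beta> t \<cdot>\<^sub>m S) $$ (r, s))"
      using rs S by simp
  qed (use S in auto)
  moreover have "u t * mat_adjoint (u t) = 1\<^sub>m N" if t: "t \<in> {0..1}" for t
  proof -
    have S_sym: "cnj (S $$ (s, r)) = S $$ (r, s)" if "r < N" "s < N" for r s
      using index_mat_adjoint[of r S s] that S adj by simp
    have smult2: "x \<cdot>\<^sub>m (y \<cdot>\<^sub>m A) = (x * y) \<cdot>\<^sub>m A" for x y and A :: "complex mat"
      by (intro eq_matI) auto
    have "mat_adjoint (u t) = cnj (\<alpha> t) \<cdot>\<^sub>m 1\<^sub>m N + cnj (\<beta> t) \<cdot>\<^sub>m S"
      using t S by (intro eq_matI) (auto simp: u_def S_sym)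
    then have "u t * mat_adjoint (u t) =
      (\<alpha> t \<cdot>\<^sub>m 1\<^sub>m N + \<beta> t \<cdot>\<^sub>m S) * (cnj (\<alpha> t) \<cdot>\<^sub>m 1\<^sub>m N + cnj (\<beta> t) \<cdot>\<^sub>m S)"
      using t by (simp add: u_def)
    also have "\<dots> = (\<alpha> t * cnj (\<alpha> t)) \<cdot>\<^sub>m 1\<^sub>m N + (\<beta> t * cnj (\<alpha> t)) \<cdot>\<^sub>m S
        + ((\<alpha> t * cnj (\<beta> t)) \<cdot>\<^sub>m S + (\<beta> t * cnj (\<beta> t)) \<cdot>\<^sub>m 1\<^sub>m N)"
      using S sq by (simp add: mult_add_distrib_mat[of _ N N _ N] add_mult_distrib_mat[of _ N N _ _ N]
          mult_smult_distrib[of _ N N _ N] mult_smult_assoc_mat[of _ N N _ N] smult2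
          add_smult_distrib_left_mat[of _ N N] mult.commute)
    also have "\<dots> = 1\<^sub>m N"
    proof (rule eq_matI)
      fix r s assume rs: "r < dim_row (1\<^sub>m N :: complex mat)" "s < dim_col (1\<^sub>m N :: complex mat)"
      let ?i = "1\<^sub>m N $$ (r, s) :: complex"
      have "\<alpha> t * cnj (\<alpha> t) * ?i + \<beta> t * cnj (\<alpha> t) * S $$ (r, s)
          + (\<alpha> t * cnj (\<beta> t) * S $$ (r, s) + \<beta> t * cnj (\<beta> t) * ?i) =
          (\<alpha> t * cnj (\<alpha> t) + \<beta> t * cnj (\<beta> t)) * ?i
          + (\<alpha> t * cnj (\<beta> t) + \<beta> t * cnj (\<alpha> t)) * S $$ (r, s)"
        by (simp add: algebra_simps)
      also have "\<dots> = ?i" unfolding 1 2 by simp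
      finally show "((\<alpha> t * cnj (\<alpha> t)) \<cdot>\<^sub>m 1\<^sub>m N + (\<beta> t * cnj (\<alpha> t)) \<cdot>\<^sub>m S
        + ((\<alpha> t * cnj (\<beta> t)) \<cdot>\<^sub>m S + (\<beta> t * cnj (\<beta> t)) \<cdot>\<^sub>m 1\<^sub>m N)) $$ (r, s) = 1\<^sub>m N $$ (r, s)"
        using rs S by (simp del: index_one_mat(1))
    qed (use S in auto)
    finally show ?thesis .
  qed
  ultimately have "cm_unitary N u" by (rule cm_unitaryI)
  moreover have "u 0 = 1\<^sub>m N" "u 1 = S"
    using S by (auto simp: u_def \<alpha>_def \<beta>_def w_def intro!: eq_matI)
  ultimately show ?thesis unfolding unitary_path_def by blast
qed

text \<open>In this convention \<open>\<sigma> r\<close> is the source of what arrives at position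
  \<open>r\<close>. Consequently products reverse the order of composition.\<close>

definition perm_mat :: "nat \<Rightarrow> (nat \<Rightarrow> nat) \<Rightarrow> complex mat" where
  "perm_mat N \<sigma> = mat N N (\<lambda>(r, s). if \<sigma> r = s then 1 else 0)"

lemma perm_mat_carrier [simp]: "perm_mat N \<sigma> \<in> carrier_mat N N"
  by (simp add: perm_mat_def)

lemma perm_mat_times:
  assumes "X \<in> carrier_mat N N" "\<And>r. r < N \<Longrightarrow> \<sigma> r < N"
  shows "perm_mat N \<sigma> * X = mat N N (\<lambda>(r, s). X $$ (\<sigma> r, s))"
  using assms
  by (intro eq_matI) (auto simp: perm_mat_def scalar_prod_def if_distrib[of "\<lambda>x. x * _"] cong: if_cong)

lemma perm_mat_conj:
  assumes X: "X \<in> carrier_mat N N" and \<sigma>: "\<And>r. r < N \<Longrightarrow> \<sigma> r < N"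
  shows "perm_mat N \<sigma> * X * mat_adjoint (perm_mat N \<sigma>) = mat N N (\<lambda>(r, s). X $$ (\<sigma> r, \<sigma> s))"
  unfolding perm_mat_times[OF assms]
  using assms
  by (intro eq_matI)
    (auto simp: perm_mat_def scalar_prod_def if_distrib[of "\<lambda>x. x * _"]
      if_distrib[of "\<lambda>x. _ * x"] if_distrib[of cnj] cong: if_cong)

text \<open>Induction over transpositions: the matrix of a transposition is a self-adjoint matrix
  with square one, hence is reached by \<open>unitary_path_symmetry\<close>.\<close>

lemma unitary_path_permutes:
  assumes "\<sigma> permutes {..<N}"
  shows "unitary_path N (perm_mat N \<sigma>)"
  using assms finite_lessThan
proof (induction rule: permutes_induct)
  case id
  have "perm_mat N id = 1\<^sub>m N" by (intro eq_matI) (auto simp: perm_mat_def)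
  then show ?case by (simp only: unitary_path_one)
next
  case (swap a b p)
  let ?T = "perm_mat N (Transposition.transpose a b)"
  have \<tau>: "Transposition.transpose a b r < N" if "r < N" for r
    using swap that by (auto simp: Transposition.transpose_def)
  have p: "p r < N" if "r < N" for r
    using permutes_in_image[OF \<open>p permutes {..<N}\<close>, of r] that by simp
  have "mat_adjoint ?T = ?T"
    by (intro eq_matI) (auto simp: perm_mat_def Transposition.transpose_def)
  moreover have "?T * ?T = 1\<^sub>m N"
    using \<tau> by (subst perm_mat_times) (auto simp: perm_mat_def intro!: eq_matI)
  ultimately have "unitary_path N ?T"
    by (intro unitary_path_symmetry) simp_all
  then have "unitary_path N (perm_mat N p * ?T)"
    using swap by (intro unitary_path_mult)
  also have "perm_mat N p * ?T = perm_mat N (Transposition.transpose a b \<circ> p)"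
    using p by (subst perm_mat_times) (auto simp: perm_mat_def intro!: eq_matI)
  finally show ?case .
qed

text \<open>An injective self-map of a finite set is bijective, so no surjectivity of the explicit
  index maps has to be checked. As \<open>permutes\<close> asks for the identity outside the set,
  \<open>\<sigma>\<close> is changed there, which \<open>perm_mat N\<close> does not see.\<close>

lemma unitary_path_inj:
  assumes "inj_on \<sigma> {..<N}" "\<And>r. r < N \<Longrightarrow> \<sigma> r < N"
  shows "unitary_path N (perm_mat N \<sigma>)"
proof -
  let ?\<sigma> = "\<lambda>r. if r < N then \<sigma> r else r"
  have "inj_on ?\<sigma> {..<N}" using assms(1) by (auto simp: inj_on_def)
  moreover from this have "?\<sigma> ` {..<N} = {..<N}"
    using assms(2) by (intro endo_inj_surj) auto
  ultimately have "?\<sigma> permutes {..<N}"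
    by (intro bij_imp_permutes) (auto simp: bij_betw_def)
  then have "unitary_path N (perm_mat N ?\<sigma>)" by (rule unitary_path_permutes)
  also have "perm_mat N ?\<sigma> = perm_mat N \<sigma>" by (auto simp: perm_mat_def intro!: cong_mat)
  finally show ?thesis .
qed

text \<open>The path is \<open>u (1 - t) * v t\<close>. Reversing time is a \<open>diag_comp\<close>
  with a single map, so its unitarity is already known.\<close>

lemma unitary_path_between:
  assumes "unitary_path N P" "unitary_path N Q"
  shows "\<exists>u. cm_unitary N u \<and> u 0 = P \<and> u 1 = Q"
proof -
  obtain u v where u: "cm_unitary N u" "u 0 = 1\<^sub>m N" "u 1 = P"
    and v: "cm_unitary N v" "v 0 = 1\<^sub>m N" "v 1 = Q"
    using assms by (auto simp: unitary_path_def)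
  have \<xi>: "interval_maps 1 (\<lambda>_ t. 1 - t)"
    by (auto simp: interval_maps_def intro!: continuous_intros)
  let ?u = "diag_comp u 1 (\<lambda>_ t. 1 - t)"
  have "cm_unitary N ?u" using cm_unitary_diag_comp[OF u(1) \<xi>] by simp
  moreover have "?u 0 = P" "?u 1 = 1\<^sub>m N"
    using u by (simp_all add: diag_comp_def del: diag_block_mat.simps)
  moreover have "P \<in> carrier_mat N N" "Q \<in> carrier_mat N N"
    using cont_mat_carrier[OF cm_unitaryD(1)[OF u(1)], of 1] u
      cont_mat_carrier[OF cm_unitaryD(1)[OF v(1)], of 1] v by auto
  ultimately show ?thesis
    using v by (intro exI[of _ "cm_mult ?u v"] conjI cm_unitary_cm_mult) (simp_all add: cm_mult_def)
qed

subsection \<open>Closure properties of building blocks\<close>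

lemma building_block_iff:
  assumes "0 < n"
  shows "f \<in> building_block n ((a + 1) * n) \<longleftrightarrow> f \<in> cont_mat ((a + 1) * n) \<and>
    (\<exists>c\<in>carrier_mat n n. f 0 = bdiag (a + 1) n (\<lambda>k. if k < a then c else 0\<^sub>m n n) \<and>
       f 1 = bdiag (a + 1) n (\<lambda>_. c))"
proof -
  have "diag_block_mat (replicate a c @ [0\<^sub>m n n]) = bdiag (a + 1) n (\<lambda>k. if k < a then c else 0\<^sub>m n n)"
    and "diag_block_mat (replicate (a + 1) c) = bdiag (a + 1) n (\<lambda>_. c)"
    if "c \<in> carrier_mat n n" for c :: "complex mat"
  proof -
    have *: "replicate a c @ [0\<^sub>m n n] = map (\<lambda>k. if k < a then c else 0\<^sub>m n n) [0..<a + 1]"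
      by (intro nth_equalityI) (auto simp: nth_append)
    show "diag_block_mat (replicate a c @ [0\<^sub>m n n]) = bdiag (a + 1) n (\<lambda>k. if k < a then c else 0\<^sub>m n n)"
      unfolding * using that by (intro diag_block_mat_map_eq_bdiag) auto
    have *: "replicate (a + 1) c = map (\<lambda>_. c) [0..<a + 1]"
      by (simp only: map_replicate_const length_upt diff_zero)
    show "diag_block_mat (replicate (a + 1) c) = bdiag (a + 1) n (\<lambda>_. c)"
      unfolding * using that by (intro diag_block_mat_map_eq_bdiag)
  qed
  moreover have "(a + 1) * n div n - 1 = a" using assms by simp
  ultimately show ?thesis
    unfolding building_block_def Let_def mem_Collect_eq by (metis (no_types, lifting))
qed

context
  fixes n a :: nat and A :: "(real \<Rightarrow> complex mat) set"
  assumes n: "0 < n"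
  defines "A \<equiv> building_block n ((a + 1) * n)"
begin

lemma building_blockE:
  assumes "f \<in> A"
  obtains c where "f \<in> cont_mat ((a + 1) * n)" "c \<in> carrier_mat n n"
    "f 0 = bdiag (a + 1) n (\<lambda>k. if k < a then c else 0\<^sub>m n n)" "f 1 = bdiag (a + 1) n (\<lambda>_. c)"
  using assms unfolding A_def building_block_iff[OF n] by blast

lemma building_blockI:
  assumes "f \<in> cont_mat ((a + 1) * n)" "c \<in> carrier_mat n n"
    "f 0 = bdiag (a + 1) n (\<lambda>k. if k < a then c else 0\<^sub>m n n)" "f 1 = bdiag (a + 1) n (\<lambda>_. c)"
  shows "f \<in> A"
  using assms unfolding A_def building_block_iff[OF n] by blast

lemma building_block_subset: "A \<subseteq> cont_mat ((a + 1) * n)"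
  by (auto elim: building_blockE)

text \<open>Here and in the next three lemmas, the operation applied to the end matrices
  \<open>c\<close> gives the new end matrix: \<open>bdiag\<close> commutes with the operation, and
  the zero block stays zero.\<close>

lemma building_block_cm_add:
  assumes "f \<in> A" "g \<in> A"
  shows "cm_add f g \<in> A"
proof -
  obtain c where c: "f \<in> cont_mat ((a + 1) * n)" "c \<in> carrier_mat n n"
    "f 0 = bdiag (a + 1) n (\<lambda>k. if k < a then c else 0\<^sub>m n n)" "f 1 = bdiag (a + 1) n (\<lambda>_. c)"
    using assms(1) by (rule building_blockE)
  obtain d where d: "g \<in> cont_mat ((a + 1) * n)" "d \<in> carrier_mat n n"
    "g 0 = bdiag (a + 1) n (\<lambda>k. if k < a then d else 0\<^sub>m n n)" "g 1 = bdiag (a + 1) n (\<lambda>_. d)"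
    using assms(2) by (rule building_blockE)
  show ?thesis
  proof (rule building_blockI[of _ "c + d"])
    show "cm_add f g 0 = bdiag (a + 1) n (\<lambda>k. if k < a then c + d else 0\<^sub>m n n)"
      using c d by (simp add: cm_add_def bdiag_add[symmetric]) (auto intro!: bdiag_cong)
    show "cm_add f g 1 = bdiag (a + 1) n (\<lambda>_. c + d)"
      using c d by (simp add: cm_add_def bdiag_add[symmetric])
  qed (use c d in \<open>auto intro: cont_mat_cm_add\<close>)
qed

lemma building_block_cm_smult:
  assumes "f \<in> A"
  shows "cm_smult z f \<in> A"
proof -
  obtain c where c: "f \<in> cont_mat ((a + 1) * n)" "c \<in> carrier_mat n n"
    "f 0 = bdiag (a + 1) n (\<lambda>k. if k < a then c else 0\<^sub>m n n)" "f 1 = bdiag (a + 1) n (\<lambda>_. c)"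
    using assms(1) by (rule building_blockE)
  show ?thesis
  proof (rule building_blockI[of _ "z \<cdot>\<^sub>m c"])
    show "cm_smult z f 0 = bdiag (a + 1) n (\<lambda>k. if k < a then z \<cdot>\<^sub>m c else 0\<^sub>m n n)"
      using c by (simp add: cm_smult_def bdiag_smult[symmetric]) (auto intro!: bdiag_cong)
    show "cm_smult z f 1 = bdiag (a + 1) n (\<lambda>_. z \<cdot>\<^sub>m c)"
      using c by (simp add: cm_smult_def bdiag_smult[symmetric])
  qed (use c in \<open>auto intro: cont_mat_cm_smult\<close>)
qed

lemma building_block_cm_mult:
  assumes "f \<in> A" "g \<in> A"
  shows "cm_mult f g \<in> A"
proof -
  obtain c where c: "f \<in> cont_mat ((a + 1) * n)" "c \<in> carrier_mat n n"
    "f 0 = bdiag (a + 1) n (\<lambda>k. if k < a then c else 0\<^sub>m n n)" "f 1 = bdiag (a + 1) n (\<lambda>_. c)"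
    using assms(1) by (rule building_blockE)
  obtain d where d: "g \<in> cont_mat ((a + 1) * n)" "d \<in> carrier_mat n n"
    "g 0 = bdiag (a + 1) n (\<lambda>k. if k < a then d else 0\<^sub>m n n)" "g 1 = bdiag (a + 1) n (\<lambda>_. d)"
    using assms(2) by (rule building_blockE)
  show ?thesis
  proof (rule building_blockI[of _ "c * d"])
    show "cm_mult f g 0 = bdiag (a + 1) n (\<lambda>k. if k < a then c * d else 0\<^sub>m n n)"
      using c d by (simp add: cm_mult_def bdiag_mult) (auto intro!: bdiag_cong)
    show "cm_mult f g 1 = bdiag (a + 1) n (\<lambda>_. c * d)"
      using c d by (simp add: cm_mult_def bdiag_mult)
  qed (use c d in \<open>auto intro: cont_mat_cm_mult\<close>)
qed

lemma building_block_cm_star: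
  assumes "f \<in> A"
  shows "cm_star f \<in> A"
proof -
  obtain c where c: "f \<in> cont_mat ((a + 1) * n)" "c \<in> carrier_mat n n"
    "f 0 = bdiag (a + 1) n (\<lambda>k. if k < a then c else 0\<^sub>m n n)" "f 1 = bdiag (a + 1) n (\<lambda>_. c)"
    using assms(1) by (rule building_blockE)
  have z: "mat_adjoint (0\<^sub>m n n) = (0\<^sub>m n n :: complex mat)" by (intro eq_matI) auto
  show ?thesis
  proof (rule building_blockI[of _ "mat_adjoint c"])
    show "cm_star f 0 = bdiag (a + 1) n (\<lambda>k. if k < a then mat_adjoint c else 0\<^sub>m n n)"
      using c by (simp add: cm_star_def bdiag_adjoint[symmetric]) (auto intro!: bdiag_cong simp: z)
    show "cm_star f 1 = bdiag (a + 1) n (\<lambda>_. mat_adjoint c)"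
      using c by (simp add: cm_star_def bdiag_adjoint[symmetric])
  qed (use c in \<open>auto intro: cont_mat_cm_star\<close>)
qed

end

subsection \<open>The permutations at the two endpoints\<close>

context
  fixes n a b N n' :: nat
  assumes n: "0 < n" and b: "b = 2 * a + 1" and N: "N = (a + 1) * n" and n': "n' = b * n"
begin

text \<open>
  The building block with parameters \<open>n\<close>, \<open>a\<close> has matrices of size \<open>N\<close>, the next one has parameters
  \<open>n'\<close>, \<open>b\<close>. An index \<open>r < (b + 1) * n'\<close> belongs to the block \<open>r div n'\<close> of size
  \<open>n' = a * n + N\<close>, which is to hold \<open>corner c (f (1/2))\<close>: \<open>a\<close> copies of \<open>c\<close>, then \<open>f (1/2)\<close>.
  At \<open>t = 0\<close> the available blocks of size \<open>N\<close> are \<open>b\<close> copies of \<open>diag(c, \<dots>, c, 0)\<close>, then \<open>b\<close> copies of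
  \<open>f (1/2)\<close>; \<open>rows0 r\<close> is the position in them that is moved to \<open>r\<close>. The zeros of all the
  blocks go to the last block \<open>r div n' = b\<close>. At \<open>t = 1\<close> there are \<open>b + 1\<close> copies of \<open>f (1/2)\<close>,
  then \<open>(b - 1) * (a + 1) = (b + 1) * a\<close> copies of \<open>c\<close>, and \<open>rows1\<close> plays the same role.
\<close>

definition row_block0 :: "nat \<Rightarrow> nat" where
  "row_block0 r = (if r div n' < b then if r mod n' < a * n then r div n' else b + r div n'
     else r mod n' div n)"

definition row_offset0 :: "nat \<Rightarrow> nat" where
  "row_offset0 r = (if r div n' < b then if r mod n' < a * n then r mod n' else r mod n' - a * n
     else a * n + r mod n' mod n)"

definition rows0 :: "nat \<Rightarrow> nat" where
  "rows0 r = row_block0 r * N + row_offset0 r"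

text \<open>Positions are counted in units of size \<open>n\<close>, since the \<open>a + 1\<close>
  copies of \<open>c\<close> in a source block do not line up with the \<open>a\<close> copies in a
  target block. The first \<open>(b + 1) * (a + 1)\<close> units are occupied by the copies of
  \<open>f (1/2)\<close>; the copies of \<open>c\<close> are then handed out consecutively,
  \<open>a\<close> to each target block.\<close>

definition unit1 :: "nat \<Rightarrow> nat" where
  "unit1 r = (b + 1) * (a + 1) + (r div n' * a + r mod n' div n)"

definition rows1 :: "nat \<Rightarrow> nat" where
  "rows1 r = (if r mod n' < a * n then unit1 r * n + r mod n' mod n
     else r div n' * N + (r mod n' - a * n))"

definition corner :: "complex mat \<Rightarrow> complex mat \<Rightarrow> complex mat" where
  "corner c H = mat n' n' (\<lambda>(h, h').
     if h < a * n \<and> h' < a * n then if h div n = h' div n then c $$ (h mod n, h' mod n) else 0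
     else if a * n \<le> h \<and> a * n \<le> h' then H $$ (h - a * n, h' - a * n) else 0)"

lemma size_eq: "(b + 1) * n' = 2 * b * N" "n' = a * n + N" "N = a * n + n" "0 < N" "0 < n'"
  using n by (simp_all add: b N n' algebra_simps)

text \<open>The bound \<open>r mod n' div n < b\<close> comes from \<open>n' = b * n\<close>: the
  last target block splits into \<open>b\<close> pieces of size \<open>n\<close>, one for the zero
  part of each copy of \<open>f 0\<close>.\<close>

lemma index_bounds:
  assumes "r < (b + 1) * n'"
  shows "r div n' < b + 1" "r mod n' < n'" "r mod n' div n < b" "r mod n' mod n < n"
    "r mod n' - a * n < N"
proof -
  show 1: "r mod n' < n'" using size_eq(5) by simp
  show "r div n' < b + 1" "r mod n' div n < b" "r mod n' mod n < n"
    using assms n 1 n' by (auto intro: div_less_mult)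
  show "r mod n' - a * n < N" using 1 size_eq(2,4) by linarith
qed

lemma less_N: "y < a * n \<Longrightarrow> y < N" "y < n \<Longrightarrow> a * n + y < N"
  using size_eq(3) by linarith+

section \<open>The rearrangement at \<open>t = 0\<close>\<close>

lemma rows0_bounds:
  assumes "r < (b + 1) * n'"
  shows "row_block0 r < 2 * b" "row_offset0 r < N"
  using index_bounds[OF assms] less_N by (auto simp: row_block0_def row_offset0_def)

lemma rows0_div_mod:
  assumes "r < (b + 1) * n'"
  shows "rows0 r div N = row_block0 r" "rows0 r mod N = row_offset0 r"
  unfolding rows0_def by (rule block_index_div_mod[OF rows0_bounds(2)[OF assms]])+

lemma rows0_less: "r < (b + 1) * n' \<Longrightarrow> rows0 r < 2 * b * N"
  unfolding rows0_def by (intro block_index_less rows0_bounds)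

text \<open>Three kinds of rows are kept apart by block and offset: those of \<open>c\<close> have
  block below \<open>b\<close> and offset below \<open>a * n\<close>, zero rows have block below
  \<open>b\<close> and offset at least \<open>a * n\<close>, those of \<open>H\<close> have block at
  least \<open>b\<close>.\<close>

lemma inj_on_rows0: "inj_on rows0 {..<(b + 1) * n'}"
proof (rule inj_onI)
  fix r s assume "r \<in> {..<(b + 1) * n'}" "s \<in> {..<(b + 1) * n'}" and eq: "rows0 r = rows0 s"
  then have r: "r < (b + 1) * n'" and s: "s < (b + 1) * n'" by auto
  have d: "row_block0 r = row_block0 s" "row_offset0 r = row_offset0 s"
    using eq rows0_div_mod[OF r] rows0_div_mod[OF s] by simp_all
  show "r = s"
  proof (rule eq_if_div_mod_eq[of _ n'])
    show q: "r div n' = s div n'"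
      using d index_bounds(1,3)[OF r] index_bounds(1,3)[OF s]
      unfolding row_block0_def row_offset0_def
      by (cases "r div n' < b"; cases "s div n' < b"; cases "r mod n' < a * n"; cases "s mod n' < a * n";
        simp only: if_True if_False; linarith)
    show "r mod n' = s mod n'"
    proof (cases "r div n' < b")
      case True
      with d q show ?thesis unfolding row_block0_def row_offset0_def
        by (cases "r mod n' < a * n"; cases "s mod n' < a * n"; simp only: if_True if_False; linarith)
    next
      case False
      with d q show ?thesis
        by (intro eq_if_div_mod_eq[of "r mod n'" n]) (simp_all add: row_block0_def row_offset0_def)
    qed
  qed
qed

lemma rows0_conj:
  assumes c: "c \<in> carrier_mat n n" and H: "H \<in> carrier_mat N N"
  shows "mat ((b + 1) * n') ((b + 1) * n') (\<lambda>(r, s).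
      bdiag (2 * b) N (\<lambda>q. if q < b then bdiag (a + 1) n (\<lambda>k. if k < a then c else 0\<^sub>m n n) else H)
        $$ (rows0 r, rows0 s)) =
    bdiag (b + 1) n' (\<lambda>k. if k < b then corner c H else 0\<^sub>m n' n')"
    (is "?L = ?R")
proof (rule eq_matI)
  fix r s assume "r < dim_row ?R" "s < dim_col ?R"
  then have r: "r < (b + 1) * n'" and s: "s < (b + 1) * n'" by (simp_all add: bdiag_def)
  have F: "bdiag (a + 1) n (\<lambda>k. if k < a then c else 0\<^sub>m n n) $$ (y, z) =
      (if y div n = z div n \<and> y < a * n \<and> z < a * n then c $$ (y mod n, z mod n) else 0)"
    if "y < N" "z < N" for y z
  proof -
    have "y div n < a \<longleftrightarrow> y < a * n" "z div n < a \<longleftrightarrow> z < a * n"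
      using n by (simp_all add: div_less_iff_less_mult)
    then show ?thesis
      using that n index_bdiag[of y "a + 1" n z "\<lambda>k. if k < a then c else 0\<^sub>m n n"] unfolding N
      by (auto simp del: add_mult_distrib)
  qed
  have "?L $$ (r, s) = (if row_block0 r = row_block0 s then
      (if row_block0 r < b then bdiag (a + 1) n (\<lambda>k. if k < a then c else 0\<^sub>m n n) else H)
        $$ (row_offset0 r, row_offset0 s) else 0)"
    using r s index_bdiag[OF rows0_less[OF r] rows0_less[OF s]]
    by (simp add: rows0_div_mod[OF r] rows0_div_mod[OF s])
  also have "\<dots> = (if row_block0 r = row_block0 s then
      if row_block0 r < b
      then if row_offset0 r div n = row_offset0 s div n \<and> row_offset0 r < a * n \<and> row_offset0 s < a * n
        then c $$ (row_offset0 r mod n, row_offset0 s mod n) else 0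
      else H $$ (row_offset0 r, row_offset0 s) else 0)"
    using F[OF rows0_bounds(2)[OF r] rows0_bounds(2)[OF s]] by (cases "row_block0 r < b") simp_all
  also have "\<dots> = (if r div n' = s div n' \<and> r div n' < b then corner c H $$ (r mod n', s mod n') else 0)"
  proof -
    note defs = row_block0_def row_offset0_def
    have b3: "r mod n' div n < b" "s mod n' div n < b"
      using index_bounds(3)[OF r] index_bounds(3)[OF s] .
    have corner: "corner c H $$ (r mod n', s mod n') = (if r mod n' < a * n \<and> s mod n' < a * n
        then if r mod n' div n = s mod n' div n then c $$ (r mod n' mod n, s mod n' mod n) else 0
        else if a * n \<le> r mod n' \<and> a * n \<le> s mod n' then H $$ (r mod n' - a * n, s mod n' - a * n) else 0)"
      using index_bounds(2)[OF r] index_bounds(2)[OF s] by (simp add: corner_def)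
    consider "r div n' < b" "s div n' < b" | "\<not> r div n' < b" "s div n' < b"
      | "r div n' < b" "\<not> s div n' < b" | "\<not> r div n' < b" "\<not> s div n' < b" by blast
    then show ?thesis
    proof cases
      case 1
      then show ?thesis unfolding corner
        by (cases "r mod n' < a * n"; cases "s mod n' < a * n") (simp_all add: defs)
    next
      \<comment> \<open>If a row of the last target block shares its source block with another row,
        that block is a copy of \<open>diag(c, ..., c, 0)\<close>, and the offset beyond
        \<open>a * n\<close> selects its zero part.\<close>
      case 2
      with b3 have "row_block0 r = row_block0 s \<Longrightarrow> row_block0 r < b \<and> \<not> row_offset0 r < a * n"
        by (simp add: defs)
      with 2 show ?thesis by auto
    next
      case 3
      with b3 have "row_block0 r = row_block0 s \<Longrightarrow> row_block0 r < b \<and> \<not> row_offset0 s < a * n"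
        by (simp add: defs)
      with 3 show ?thesis by auto
    next
      case 4
      with b3 have "row_block0 r < b \<and> \<not> row_offset0 r < a * n" by (simp add: defs)
      with 4 show ?thesis by auto
    qed
  qed
  also have "\<dots> = ?R $$ (r, s)"
    using r s index_bounds[OF r] index_bounds[OF s] by (auto simp: index_bdiag)
  finally show "?L $$ (r, s) = ?R $$ (r, s)" .
qed (auto simp: bdiag_def)

section \<open>The rearrangement at \<open>t = 1\<close>\<close>

lemma div_mod_N: "x div N = x div n div (a + 1)" "x mod N div n = x div n mod (a + 1)"
    "x mod N mod n = x mod n"
  unfolding N mult.commute[of "a + 1" n] mod_mult2_eq div_mult2_eq using n by simp_all

lemma rows1_front:
  assumes r: "r < (b + 1) * n'" and h: "r mod n' < a * n"
  shows "rows1 r < 2 * b * N" "b < rows1 r div N" "rows1 r div n = unit1 r" "rows1 r mod n = r mod n' mod n"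
proof -
  have eq: "rows1 r = unit1 r * n + r mod n' mod n" using h by (simp add: rows1_def)
  show 1: "rows1 r div n = unit1 r" "rows1 r mod n = r mod n' mod n"
    unfolding eq by (rule block_index_div_mod[OF index_bounds(4)[OF r]])+
  have "r div n' * a + r mod n' div n < (b + 1) * a"
    using index_bounds(1)[OF r] h n by (intro block_index_less) (simp_all add: div_less_iff_less_mult)
  \<comment> \<open>The units left over by the \<open>b + 1\<close> copies of \<open>f (1/2)\<close>
    are exactly the copies of \<open>c\<close> that are needed; this depends on
    \<open>b = 2 * a + 1\<close>.\<close>
  moreover have "2 * b * (a + 1) = (b + 1) * (a + 1) + (b + 1) * a"
    by (simp add: b algebra_simps)
  ultimately have "unit1 r < 2 * b * (a + 1)" unfolding unit1_def by linarith
  then have "rows1 r < 2 * b * (a + 1) * n"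
    unfolding eq by (rule block_index_less[OF _ index_bounds(4)[OF r]])
  then show "rows1 r < 2 * b * N" by (simp only: N mult.assoc)
  have "rows1 r div N = unit1 r div (a + 1)"
    unfolding div_mod_N(1) 1 ..
  moreover have "b + 1 \<le> unit1 r div (a + 1)"
    by (subst less_eq_div_iff_mult_less_eq) (simp_all add: unit1_def)
  ultimately show "b < rows1 r div N" by simp
qed

lemma rows1_back:
  assumes r: "r < (b + 1) * n'" and h: "\<not> r mod n' < a * n"
  shows "rows1 r < 2 * b * N" "rows1 r div N = r div n'" "rows1 r mod N = r mod n' - a * n"
proof -
  have eq: "rows1 r = r div n' * N + (r mod n' - a * n)" using h by (simp add: rows1_def)
  show "rows1 r div N = r div n'" "rows1 r mod N = r mod n' - a * n"
    unfolding eq by (rule block_index_div_mod[OF index_bounds(5)[OF r]])+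
  have "r div n' < 2 * b" using index_bounds(1)[OF r] b by linarith
  then show "rows1 r < 2 * b * N"
    unfolding eq by (rule block_index_less[OF _ index_bounds(5)[OF r]])
qed

text \<open>Below \<open>a * n\<close> the piece number \<open>r mod n' div n\<close> is less than
  \<open>a\<close>, hence a digit in base \<open>a\<close>.\<close>

lemma unit1_inj:
  assumes "unit1 r = unit1 s" "r mod n' < a * n" "s mod n' < a * n"
  shows "r div n' = s div n'" "r mod n' div n = s mod n' div n"
proof -
  have "r mod n' div n < a" "s mod n' div n < a"
    using assms n by (simp_all add: div_less_iff_less_mult)
  moreover have "r div n' * a + r mod n' div n = s div n' * a + s mod n' div n"
    using assms(1) by (simp add: unit1_def)
  ultimately show "r div n' = s div n'" "r mod n' div n = s mod n' div n"
    by (metis block_index_div_mod(1), metis block_index_div_mod(2))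
qed

text \<open>Rows of \<open>c\<close> come from source blocks beyond \<open>b\<close>, rows of
  \<open>H\<close> from blocks up to \<open>b\<close>, so only rows of one kind can collide.\<close>

lemma inj_on_rows1: "inj_on rows1 {..<(b + 1) * n'}"
proof (rule inj_onI)
  fix r s assume "r \<in> {..<(b + 1) * n'}" "s \<in> {..<(b + 1) * n'}" and eq: "rows1 r = rows1 s"
  then have r: "r < (b + 1) * n'" and s: "s < (b + 1) * n'" by auto
  show "r = s"
  proof (cases "r mod n' < a * n")
    case True
    have hs: "s mod n' < a * n"
    proof (rule ccontr)
      assume "\<not> s mod n' < a * n"
      then show False
        using rows1_front(2)[OF r True] rows1_back(2)[OF s] index_bounds(1)[OF s] eq by simp
    qed
    have u: "unit1 r = unit1 s" and m: "r mod n' mod n = s mod n' mod n"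
      using rows1_front(3,4)[OF r True] rows1_front(3,4)[OF s hs] eq by simp_all
    note u = unit1_inj[OF u True hs]
    show ?thesis by (rule eq_if_div_mod_eq[OF u(1) eq_if_div_mod_eq[OF u(2) m]])
  next
    case False
    have hs: "\<not> s mod n' < a * n"
      using rows1_front(2)[OF s] rows1_back(2)[OF r False] index_bounds(1)[OF r] eq by auto
    have q: "r div n' = s div n'" and m: "r mod n' - a * n = s mod n' - a * n"
      using rows1_back(2,3)[OF r False] rows1_back(2,3)[OF s hs] eq by simp_all
    from m False hs have "r mod n' = s mod n'" by linarith
    with q show ?thesis by (rule eq_if_div_mod_eq)
  qed
qed

lemma rows1_less: "r < (b + 1) * n' \<Longrightarrow> rows1 r < 2 * b * N"
  by (cases "r mod n' < a * n") (simp_all only: rows1_front(1) rows1_back(1) not_False_eq_True)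

lemma rows1_conj:
  assumes c: "c \<in> carrier_mat n n" and H: "H \<in> carrier_mat N N"
  shows "mat ((b + 1) * n') ((b + 1) * n') (\<lambda>(r, s).
      bdiag (2 * b) N (\<lambda>q. if q < b + 1 then H else bdiag (a + 1) n (\<lambda>_. c)) $$ (rows1 r, rows1 s)) =
    bdiag (b + 1) n' (\<lambda>_. corner c H)"
    (is "?L = ?R")
proof (rule eq_matI)
  fix r s assume "r < dim_row ?R" "s < dim_col ?R"
  then have r: "r < (b + 1) * n'" and s: "s < (b + 1) * n'" by (simp_all add: bdiag_def)
  let ?G = "bdiag (2 * b) N (\<lambda>q. if q < b + 1 then H else bdiag (a + 1) n (\<lambda>_. c))"
  have L: "?L $$ (r, s) = ?G $$ (rows1 r, rows1 s)" using r s by simp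
  have G: "?G $$ (x, y) = (if x div N = y div N then
      (if x div N < b + 1 then H else bdiag (a + 1) n (\<lambda>_. c)) $$ (x mod N, y mod N) else 0)"
    if "x < 2 * b * N" "y < 2 * b * N" for x y by (rule index_bdiag[OF that])
  have R: "?R $$ (r, s) = (if r div n' = s div n' then corner c H $$ (r mod n', s mod n') else 0)"
    by (rule index_bdiag[OF r s])
  have corner: "corner c H $$ (r mod n', s mod n') = (if r mod n' < a * n \<and> s mod n' < a * n
      then if r mod n' div n = s mod n' div n then c $$ (r mod n' mod n, s mod n' mod n) else 0
      else if a * n \<le> r mod n' \<and> a * n \<le> s mod n' then H $$ (r mod n' - a * n, s mod n' - a * n) else 0)"
    using index_bounds(2)[OF r] index_bounds(2)[OF s] by (simp add: corner_def)
  consider "r mod n' < a * n" "s mod n' < a * n" | "\<not> r mod n' < a * n" "s mod n' < a * n"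
    | "r mod n' < a * n" "\<not> s mod n' < a * n" | "\<not> r mod n' < a * n" "\<not> s mod n' < a * n" by blast
  then show "?L $$ (r, s) = ?R $$ (r, s)"
  proof cases
    case 1
    note fr = rows1_front[OF r 1(1)] and fs = rows1_front[OF s 1(2)]
    have "bdiag (a + 1) n (\<lambda>_. c) $$ (rows1 r mod N, rows1 s mod N) =
        (if rows1 r mod N div n = rows1 s mod N div n
         then c $$ (rows1 r mod N mod n, rows1 s mod N mod n) else 0)"
      using size_eq(4) by (intro index_bdiag) (simp_all add: N)
    then have "?G $$ (rows1 r, rows1 s) = (if rows1 r div N = rows1 s div N \<and>
        rows1 r mod N div n = rows1 s mod N div n then c $$ (rows1 r mod n, rows1 s mod n) else 0)"
      using fr(2) fs(2) unfolding G[OF fr(1) fs(1)] div_mod_N(3) by simp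
    \<comment> \<open>Same source block and same place within it together mean the same unit of size
      \<open>n\<close>.\<close>
    also have "\<dots> = (if unit1 r = unit1 s then c $$ (r mod n' mod n, s mod n' mod n) else 0)"
      unfolding div_mod_N(1,2) fr(3,4) fs(3,4) using eq_if_div_mod_eq[of "unit1 r" "a + 1" "unit1 s"] by auto
    also have "unit1 r = unit1 s \<longleftrightarrow> r div n' = s div n' \<and> r mod n' div n = s mod n' div n"
      using unit1_inj[OF _ 1] by (auto simp: unit1_def)
    finally show ?thesis unfolding L R corner using 1 by simp
  next
    case 2
    have "rows1 r div N \<noteq> rows1 s div N"
      using rows1_back(2)[OF r 2(1)] rows1_front(2)[OF s 2(2)] index_bounds(1)[OF r] by linarith
    then show ?thesis unfolding L R corner G[OF rows1_less[OF r] rows1_less[OF s]] using 2 by auto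
  next
    case 3
    have "rows1 r div N \<noteq> rows1 s div N"
      using rows1_back(2)[OF s 3(2)] rows1_front(2)[OF r 3(1)] index_bounds(1)[OF s] by linarith
    then show ?thesis unfolding L R corner G[OF rows1_less[OF r] rows1_less[OF s]] using 3 by auto
  next
    case 4
    note br = rows1_back[OF r 4(1)] and bs = rows1_back[OF s 4(2)]
    show ?thesis
      unfolding L R corner G[OF br(1) bs(1)] br(2,3) bs(2,3) using 4 index_bounds(1)[OF s] by simp
  qed
qed (auto simp: bdiag_def)

end

subsection \<open>The inductive sequence\<close>

lemma exists_connecting_map:
  assumes n: "0 < n" and a: "0 < a"
  defines "A \<equiv> building_block n ((a + 1) * n)"
    and "M \<equiv> ((2 * a + 1) + 1) * ((2 * a + 1) * n)"
  shows "\<exists>\<phi>. star_hom A (building_block ((2 * a + 1) * n) M) \<phi> \<and> diag_form (1/2) ((a + 1) * n) M A \<phi>"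
proof -
  define b N n' where "b = 2 * a + 1" and "N = (a + 1) * n" and "n' = b * n"
  note params = n b_def N_def n'_def
  note size_eq = size_eq[OF params]
  have M: "M = (b + 1) * n'" by (simp only: M_def b_def n'_def)
  have M2: "2 * b * N = M" using size_eq(1) M by simp
  have b3: "3 \<le> b" using a by (simp add: b_def)
  let ?\<sigma>0 = "rows0 n a b N n'" and ?\<sigma>1 = "rows1 n a b N n'"
  have less: "r < M \<Longrightarrow> ?\<sigma>0 r < M" "r < M \<Longrightarrow> ?\<sigma>1 r < M" for r
    using rows0_less[OF params, of r] rows1_less[OF params, of r] M M2 by simp_all
  have "unitary_path M (perm_mat M ?\<sigma>0)" "unitary_path M (perm_mat M ?\<sigma>1)"
    using inj_on_rows0[OF params] inj_on_rows1[OF params] less M by (auto intro!: unitary_path_inj)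
  then obtain u where u: "cm_unitary M u" and u0: "u 0 = perm_mat M ?\<sigma>0" and u1: "u 1 = perm_mat M ?\<sigma>1"
    using unitary_path_between by blast
  \<comment> \<open>The values at 0 are \<open>b\<close> times 0, then \<open>b\<close> times
    \<open>1/2\<close>; at 1 they are \<open>b + 1\<close> times \<open>1/2\<close>, then
    \<open>b - 1\<close> times 1. These are the block patterns of \<open>rows0_conj\<close> and
    \<open>rows1_conj\<close>.\<close>
  define \<xi> :: "nat \<Rightarrow> real \<Rightarrow> real" where
    "\<xi> k t = (if k \<le> b then t / 2 else if k = b + 1 then 1 / 2 else (t + 1) / 2)" for k t
  have \<xi>: "interval_maps (2 * b) \<xi>"
    unfolding interval_maps_def
  proof (intro ballI conjI)
    fix k
    show "\<xi> k \<in> {0..1} \<rightarrow> {0..1}" by (auto simp: \<xi>_def)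
    show "continuous_on {0..1} (\<xi> k)"
      unfolding \<xi>_def by (cases "k \<le> b"; cases "k = b + 1") (auto intro!: continuous_intros)
  qed
  define \<phi> where "\<phi> f = cm_mult (cm_mult u (diag_comp f (2 * b) \<xi>)) (cm_star u)" for f
  have "(\<Union>k\<in>{1..2 * b}. \<xi> k ` {0..1}) = {0..1}"
  proof
    show "(\<Union>k\<in>{1..2 * b}. \<xi> k ` {0..1}) \<subseteq> {0..1}" by (auto simp: \<xi>_def)
    show "{0..1} \<subseteq> (\<Union>k\<in>{1..2 * b}. \<xi> k ` {0..1})"
    proof
      fix z :: real assume z: "z \<in> {0..1}"
      show "z \<in> (\<Union>k\<in>{1..2 * b}. \<xi> k ` {0..1})"
      proof (cases "z \<le> 1 / 2")
        case True
        then have "z = \<xi> 1 (2 * z)" "2 * z \<in> {0..1}" using z b3 by (auto simp: \<xi>_def)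
        moreover have "1 \<in> {1..2 * b}" using b3 by simp
        ultimately show ?thesis by blast
      next
        case False
        \<comment> \<open>By \<open>3 \<le> b\<close>, the index \<open>2 * b\<close> exceeds
          \<open>b + 1\<close>, so this map is \<open>(t + 1) / 2\<close>.\<close>
        then have "z = \<xi> (2 * b) (2 * z - 1)" "2 * z - 1 \<in> {0..1}" using z b3 by (auto simp: \<xi>_def)
        moreover have "2 * b \<in> {1..2 * b}" using b3 by simp
        ultimately show ?thesis by blast
      qed
    qed
  qed
  moreover have "\<bar>\<xi> k x - \<xi> k y\<bar> \<le> 1 / 2 * \<bar>x - y\<bar>" for k x y
  proof -
    have "\<xi> k x - \<xi> k y = (x - y) / 2 \<or> \<xi> k x - \<xi> k y = 0"
      by (auto simp: \<xi>_def field_simps)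
    then show ?thesis by (elim disjE) (simp_all only: abs_divide, simp_all)
  qed
  ultimately have form: "diag_form (1 / 2) ((a + 1) * n) M A \<phi>"
    unfolding diag_form_def using u \<xi> \<phi>_def M2 N_def by blast
  have "\<phi> f \<in> building_block n' ((b + 1) * n')" if "f \<in> A" for f
  proof -
    obtain c where f: "f \<in> cont_mat N" and c: "c \<in> carrier_mat n n"
      and f0: "f 0 = bdiag (a + 1) n (\<lambda>k. if k < a then c else 0\<^sub>m n n)"
      and f1: "f 1 = bdiag (a + 1) n (\<lambda>_. c)"
      using building_blockE[OF n \<open>f \<in> A\<close>[unfolded A_def]] unfolding N_def by metis
    have H: "f (1 / 2) \<in> carrier_mat N N" by (rule cont_mat_carrier[OF f]) simp
    have D: "diag_comp f (2 * b) \<xi> \<in> cont_mat M" using cont_mat_diag_comp[OF f \<xi>] M2 by simp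
    let ?d = "corner n a n' c (f (1 / 2))"
    have \<phi>: "\<phi> f t = u t * bdiag (2 * b) N (\<lambda>k. f (\<xi> (Suc k) t)) * mat_adjoint (u t)" if "t \<in> {0..1}" for t
      using that diag_comp_apply[OF \<xi> f that] by (simp add: \<phi>_def cm_mult_def cm_star_def)
    have B: "bdiag (2 * b) N F \<in> carrier_mat M M" for F using bdiag_carrier[of "2 * b" N F] M2 by simp
    have "\<phi> f 0 = mat M M (\<lambda>(r, s). bdiag (2 * b) N (\<lambda>k. f (\<xi> (Suc k) 0)) $$ (?\<sigma>0 r, ?\<sigma>0 s))"
      unfolding \<phi>[of 0, simplified] u0 by (rule perm_mat_conj[OF B less(1)])
    also have "bdiag (2 * b) N (\<lambda>k. f (\<xi> (Suc k) 0)) = bdiag (2 * b) N (\<lambda>q. if q < b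
        then bdiag (a + 1) n (\<lambda>k. if k < a then c else 0\<^sub>m n n) else f (1 / 2))"
      by (rule bdiag_cong) (auto simp: \<xi>_def f0)
    finally have 0: "\<phi> f 0 = bdiag (b + 1) n' (\<lambda>k. if k < b then ?d else 0\<^sub>m n' n')"
      using rows0_conj[OF params c H] M by simp
    have "\<phi> f 1 = mat M M (\<lambda>(r, s). bdiag (2 * b) N (\<lambda>k. f (\<xi> (Suc k) 1)) $$ (?\<sigma>1 r, ?\<sigma>1 s))"
      unfolding \<phi>[of 1, simplified] u1 by (rule perm_mat_conj[OF B less(2)])
    also have "bdiag (2 * b) N (\<lambda>k. f (\<xi> (Suc k) 1)) = bdiag (2 * b) N (\<lambda>q. if q < b + 1
        then f (1 / 2) else bdiag (a + 1) n (\<lambda>_. c))"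
      by (rule bdiag_cong) (auto simp: \<xi>_def f1)
    finally have 1: "\<phi> f 1 = bdiag (b + 1) n' (\<lambda>_. ?d)"
      using rows1_conj[OF params c H] M by simp
    show ?thesis
    proof (rule building_blockI[OF size_eq(5) _ _ 0 1])
      show "?d \<in> carrier_mat n' n'" by (simp add: corner_def[OF params])
      have "\<phi> f \<in> cont_mat M"
        unfolding \<phi>_def
        by (intro cont_mat_cm_mult cont_mat_cm_star D cm_unitaryD(1)[OF u])
      then show "\<phi> f \<in> cont_mat ((b + 1) * n')" by (simp only: M)
    qed
  qed
  then have "\<phi> \<in> A \<rightarrow> building_block ((2 * a + 1) * n) M"
    unfolding M by (simp add: n'_def b_def)
  then have "star_hom A (building_block ((2 * a + 1) * n) M) \<phi>"
    unfolding A_def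
    by (intro star_hom_diag_form[OF form[unfolded A_def] _ building_block_subset[OF n]]
        building_block_cm_add[OF n] building_block_cm_smult[OF n]
        building_block_cm_mult[OF n] building_block_cm_star[OF n])
  with form show ?thesis by blast
qed

text \<open>The step from \<open>a\<close> to \<open>2 * a + 1\<close>, started at 1, gives
  \<open>2 ^ (i + 1) - 1\<close>. Index 0 carries \<open>A(1, 2)\<close>, so the sequence required,
  from index 1 on, begins with \<open>A(3, 12)\<close>.\<close>

primrec mult_seq :: "nat \<Rightarrow> nat" where
  "mult_seq 0 = 1"
| "mult_seq (Suc i) = 2 * mult_seq i + 1"

primrec size_seq :: "nat \<Rightarrow> nat" where
  "size_seq 0 = 1"
| "size_seq (Suc i) = (2 * mult_seq i + 1) * size_seq i"

lemma mult_seq_pos: "0 < mult_seq i"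
  by (induction i) auto

lemma size_seq_pos: "0 < size_seq i"
  by (induction i) auto

theorem proposition3p1:
  shows "\<exists>(n :: nat \<Rightarrow> nat) (a :: nat \<Rightarrow> nat)
           (\<phi> :: nat \<Rightarrow> (real \<Rightarrow> complex mat) \<Rightarrow> real \<Rightarrow> complex mat).
    (\<forall>i\<ge>1. 0 < n i \<and> 0 < a i) \<and>
    inductive_sequence (\<lambda>i. building_block (n i) ((a i + 1) * n i)) \<phi> \<and>
    (\<forall>i j. 1 \<le> i \<and> i \<le> j \<longrightarrow>
       star_hom (building_block (n i) ((a i + 1) * n i))
                (building_block (n j) ((a j + 1) * n j)) (connecting_map \<phi> i j) \<and>
       (\<exists>(m :: nat) (u :: real \<Rightarrow> complex mat) (\<xi> :: nat \<Rightarrow> real \<Rightarrow> real).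
          m * ((a i + 1) * n i) = (a j + 1) * n j \<and>
          cm_unitary ((a j + 1) * n j) u \<and>
          (\<forall>k\<in>{1..m}. \<xi> k \<in> {0..1} \<rightarrow> {0..1} \<and> continuous_on {0..1} (\<xi> k)) \<and>
          (\<forall>f \<in> building_block (n i) ((a i + 1) * n i).
             connecting_map \<phi> i j f = cm_mult (cm_mult u (diag_comp f m \<xi>)) (cm_star u)) \<and>
          (\<forall>k\<in>{1..m}. \<forall>x\<in>{0..1}. \<forall>y\<in>{0..1}. \<bar>\<xi> k x - \<xi> k y\<bar> \<le> (1 / 2) ^ (j - i)) \<and>
          (\<Union>k\<in>{1..m}. \<xi> k ` {0..1}) = {0..1}))"
proof -
  define N where "N i = (mult_seq i + 1) * size_seq i" for i
  define A where "A i = building_block (size_seq i) (N i)" for i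
  have "\<exists>\<phi>. star_hom (A i) (A (Suc i)) \<phi> \<and> diag_form (1 / 2) (N i) (N (Suc i)) (A i) \<phi>" for i
    using exists_connecting_map[OF size_seq_pos mult_seq_pos, of i i]
    unfolding A_def N_def mult_seq.simps size_seq.simps .
  then obtain \<phi> where hom: "\<And>i. star_hom (A i) (A (Suc i)) (\<phi> i)"
    and form: "\<And>i. diag_form (1 / 2) (N i) (N (Suc i)) (A i) (\<phi> i)"
    by metis
  have sub: "A i \<subseteq> cont_mat (N i)" for i
    unfolding A_def N_def by (rule building_block_subset[OF size_seq_pos])
  \<comment> \<open>Both parts go through one induction because \<open>diag_form_comp\<close> needs
    the map so far to take values in \<open>A j\<close>, which \<open>star_hom\<close>
    provides.\<close>
  have main: "star_hom (A i) (A j) (connecting_map \<phi> i j) \<and>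
      diag_form ((1 / 2) ^ (j - i)) (N i) (N j) (A i) (connecting_map \<phi> i j)" if "i \<le> j" for i j
    using that
  proof (induction j rule: dec_induct)
    case base
    have "connecting_map \<phi> i i = id" by (simp add: connecting_map_def)
    then show ?case
      by (simp only: diff_self_eq_0 power_0 star_hom_id diag_form_id[OF sub] simp_thms)
  next
    case (step j)
    have eq: "connecting_map \<phi> i (Suc j) = \<phi> j \<circ> connecting_map \<phi> i j"
      using step(1) by (simp add: connecting_map_def fun_eq_iff)
    have "diag_form ((1 / 2) ^ (j - i) * (1 / 2)) (N i) (N (Suc j)) (A i) (\<phi> j \<circ> connecting_map \<phi> i j)"
      using step(3) by (intro diag_form_comp[OF _ form _ sub]) (simp_all add: star_hom_def)
    moreover have "(1 / 2) ^ (j - i) * (1 / 2) = (1 / 2 :: real) ^ (Suc j - i)"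
      using step(1) by (simp add: Suc_diff_le)
    ultimately show ?case
      using step(3) star_hom_comp[OF _ hom] unfolding eq by metis
  qed
  have shape: "\<exists>m u \<xi>. m * N i = N j \<and> cm_unitary (N j) u \<and>
      (\<forall>k\<in>{1..m}. \<xi> k \<in> {0..1} \<rightarrow> {0..1} \<and> continuous_on {0..1} (\<xi> k)) \<and>
      (\<forall>f \<in> A i. connecting_map \<phi> i j f = cm_mult (cm_mult u (diag_comp f m \<xi>)) (cm_star u)) \<and>
      (\<forall>k\<in>{1..m}. \<forall>x\<in>{0..1}. \<forall>y\<in>{0..1}. \<bar>\<xi> k x - \<xi> k y\<bar> \<le> (1 / 2) ^ (j - i)) \<and>
      (\<Union>k\<in>{1..m}. \<xi> k ` {0..1}) = {0..1}" if ij: "i \<le> j" for i j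
  proof -
    obtain m u \<xi> where *: "m * N i = N j" "cm_unitary (N j) u" "interval_maps m \<xi>"
      "\<forall>f \<in> A i. connecting_map \<phi> i j f = cm_mult (cm_mult u (diag_comp f m \<xi>)) (cm_star u)"
      "(\<Union>k\<in>{1..m}. \<xi> k ` {0..1}) = {0..1}"
      and lip: "\<forall>k\<in>{1..m}. \<forall>x\<in>{0..1}. \<forall>y\<in>{0..1}. \<bar>\<xi> k x - \<xi> k y\<bar> \<le> (1 / 2) ^ (j - i) * \<bar>x - y\<bar>"
      using main[OF ij] unfolding diag_form_def by blast
    \<comment> \<open>The interval has length one, so the Lipschitz constant also bounds the
      oscillation.\<close>
    have "\<bar>\<xi> k x - \<xi> k y\<bar> \<le> (1 / 2) ^ (j - i)" if "k \<in> {1..m}" "x \<in> {0..1}" "y \<in> {0..1}" for k x y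
    proof -
      have "\<bar>\<xi> k x - \<xi> k y\<bar> \<le> (1 / 2) ^ (j - i) * \<bar>x - y\<bar>" using lip that by blast
      also have "\<dots> \<le> (1 / 2) ^ (j - i) * 1"
        using that by (intro mult_left_mono) (auto simp: abs_le_iff)
      finally show ?thesis by simp
    qed
    with * show ?thesis
      unfolding interval_maps_def by (intro exI[of _ m] exI[of _ u] exI[of _ \<xi>]) blast
  qed
  have ind: "inductive_sequence (\<lambda>i. building_block (size_seq i) ((mult_seq i + 1) * size_seq i)) \<phi>"
    using hom unfolding inductive_sequence_def A_def N_def by blast
  show ?thesis
    by (rule exI[of _ size_seq], rule exI[of _ mult_seq], rule exI[of _ \<phi>],
        intro conjI allI impI size_seq_pos mult_seq_pos ind; elim conjE;
        (rule main[THEN conjunct1, unfolded A_def N_def] | rule shape[unfolded A_def N_def]); assumption)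
qed

end
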